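(* Let $G_2=\mathrm{Aut}(\mathbb{O})$ and $$M_2:=\{(w,W):\ W\in M_1,\ w\in W\cap\mathbb{O}_0,\ n(w)=1\}.$$ The group $G_2$ acts transitively on $M_2$ by $f\cdot(w,W)=(f(w),f(W))$. The isotropy subgroup of $(\mathbf{i},\mathbb{H})\in M_2$ is $$H_2=\{f\in\mathrm{Aut}(\mathbb{O}):\ f(\mathbb{H})\subset\mathbb{H},\ f(\mathbf{i})=\mathbf{i}\},$$ and the restriction $f\mapsto f|_{\mathbb{H}^\perp}$ is an isomorphism $H_2\to\mathrm{U}(\mathbb{H}^\perp,\sigma)\cong\mathrm{U}(2)$. Hence $M_2\cong G_2/\mathrm{U}(2)$. Moreover, the map $$\widetilde{\mathrm{Gr}}_{7,2}\longrightarrow M_2,\qquad \Pi\mapsto\big(X_1\times X_2,\ \langle 1,X_1,X_2,X_1\times X_2\rangle\big),$$ where $\{X_1,X_2\}$ is any oriented orthonormal basis of $\Pi$, is a $G_2$-equivariant identification, whose inverse sends $(w,W)$ to the plane $W\cap\langle 1,w\rangle^\perp$ oriented by $\{X,w\times X\}$ for any $X\in W\cap\langle 1,w\rangle^\perp$ with $n(X)=1$.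
   Context: $\mathbb{O}=\mathbb{H}\oplus\mathbb{H}\mathbf{l}$ is the real octonion division algebra, where $\mathbb{H}=\langle 1,\mathbf{i},\mathbf{j},\mathbf{k}\rangle$ is the usual quaternion algebra, and for $q_1,q_2\in\mathbb{H}$: $q_1(q_2\mathbf{l})=(q_2q_1)\mathbf{l}$, $(q_2\mathbf{l})q_1=(q_2\overline{q_1})\mathbf{l}$, $(q_1\mathbf{l})(q_2\mathbf{l})=-\overline{q_2}q_1$. $n$ is the octonion norm (also its polar form, $n(x,x)=n(x)$), $\mathbb{O}_0=\{1\}^\perp\equiv\mathbb{R}^7$ the trace-zero octonions, and $x\times y=\mathrm{pr}_{\mathbb{O}_0}(xy)$ the cross product on $\mathbb{O}_0$. $\mathrm{Aut}(\mathbb{O})$ is the group of algebra automorphisms; its elements preserve $\mathbb{O}_0$, $n$ and $\times$. $M_1$ is the set of 4-dimensional subalgebras of $\mathbb{O}$. The Hermitian form $\sigma\colon\mathbb{O}\times\mathbb{O}\to\mathbb{C}$ is $\sigma(x,y)=n(x,y)-n(\mathbf{i}x,y)\mathbf{i}$ (with $\mathbb{C}=\langle1,\mathbf{i}\rangle$ acting on $\mathbb{H}^\perp=\mathbb{H}\mathbf{l}$ by left octonion multiplication). $\widetilde{\mathrm{Gr}}_{7,2}$ is the Grassmannian of oriented 2-planes in $\mathbb{R}^7\equiv\mathbb{O}_0$, with the natural $G_2$-action. *)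

theory Defs
  imports "HOL-Analysis.Analysis" "HOL-Algebra.Group_Action" "HOL-Algebra.Left_Coset"
begin

section \<open>Quaternions and octonions\<close>

text \<open>
  Quaternions \<open>a + b i + c j + d k\<close> are quadruples of reals, and the octonion \<open>q\<^sub>1 + q\<^sub>2 l\<close> is the
  pair \<open>(q\<^sub>1, q\<^sub>2)\<close>.  The library's product instances supply the Euclidean structure: \<open>x \<bullet> y\<close> is the
  polar form of the octonion norm \<open>n\<close>, and \<open>x \<bullet> x\<close> is \<open>n(x)\<close> (see \<open>omult_ocnj\<close>), whereas the
  library's \<open>norm\<close> is its square root.
\<close>

type_synonym quaternion = "real \<times> real \<times> real \<times> real"
type_synonym octonion = "quaternion \<times> quaternion"

fun qmult :: "quaternion \<Rightarrow> quaternion \<Rightarrow> quaternion" where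
  "qmult (a, b, c, d) (a', b', c', d') =
     (a * a' - b * b' - c * c' - d * d',
      a * b' + b * a' + c * d' - d * c',
      a * c' - b * d' + c * a' + d * b',
      a * d' + b * c' - c * b' + d * a')"

fun qcnj :: "quaternion \<Rightarrow> quaternion" where
  "qcnj (a, b, c, d) = (a, - b, - c, - d)"

fun omult :: "octonion \<Rightarrow> octonion \<Rightarrow> octonion"  (infixl \<open>\<odot>\<close> 70) where
  "(p, q) \<odot> (r, s) = (qmult p r - qmult (qcnj s) q, qmult s p + qmult q (qcnj r))"

fun ocnj :: "octonion \<Rightarrow> octonion" where
  "ocnj (p, q) = (qcnj p, - q)"

definition oct_1 :: octonion where "oct_1 = ((1, 0, 0, 0), 0)"
definition oct_i :: octonion where "oct_i = ((0, 1, 0, 0), 0)"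
definition oct_j :: octonion where "oct_j = ((0, 0, 1, 0), 0)"
definition oct_k :: octonion where "oct_k = ((0, 0, 0, 1), 0)"
definition oct_l :: octonion where "oct_l = (0, (1, 0, 0, 0))"

lemma quaternion_table:
  "oct_i \<odot> oct_j = oct_k" "oct_j \<odot> oct_k = oct_i" "oct_k \<odot> oct_i = oct_j"
  "oct_i \<odot> oct_i = - oct_1" "oct_j \<odot> oct_j = - oct_1" "oct_k \<odot> oct_k = - oct_1"
  by (simp_all add: oct_1_def oct_i_def oct_j_def oct_k_def zero_prod_def)

lemma octonion_rules:
  "(q, 0) \<odot> oct_l = (0, q)"
  "(q1, 0) \<odot> (0, q2) = (0, qmult q2 q1)"
  "(0, q2) \<odot> (q1, 0) = (0, qmult q2 (qcnj q1))"
  "(0, q1) \<odot> (0, q2) = (- qmult (qcnj q2) q1, 0)"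
  by (cases q; cases q1; cases q2; simp add: zero_prod_def oct_l_def)+

lemma octonion_cases:
  obtains a b c d a' b' c' d' :: real where "x = ((a, b, c, d), (a', b', c', d'))"
proof -
  obtain p q where pq: "x = (p, q)"
    by (cases x)
  show thesis
    by (rule qcnj.cases [of p]; rule qcnj.cases [of q]) (rule that, simp add: pq)
qed

lemma omult_one: "oct_1 \<odot> x = x" "x \<odot> oct_1 = x"
  by (rule octonion_cases [of x]; simp add: oct_1_def zero_prod_def)+

lemma omult_ocnj: "x \<odot> ocnj x = (x \<bullet> x) *\<^sub>R oct_1"
  by (rule octonion_cases [of x]) (simp add: oct_1_def zero_prod_def)

definition Quat :: "octonion set" where
  "Quat = span {oct_1, oct_i, oct_j, oct_k}"

definition Im_Oct :: "octonion set" where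
  "Im_Oct = orthogonal_comp {oct_1}"

text \<open>The orthogonal projection onto \<open>Im_Oct\<close> of the product; meant for arguments in \<open>Im_Oct\<close>.\<close>
definition ocross :: "octonion \<Rightarrow> octonion \<Rightarrow> octonion"  (infixl \<open>\<otimes>\<^sub>O\<close> 70) where
  "x \<otimes>\<^sub>O y = x \<odot> y - ((x \<odot> y) \<bullet> oct_1) *\<^sub>R oct_1"

section \<open>The group $G_2$ and the space $M_2$\<close>

definition octonion_aut :: "(octonion \<Rightarrow> octonion) \<Rightarrow> bool" where
  "octonion_aut f \<longleftrightarrow> linear f \<and> bij f \<and> (\<forall>x y. f (x \<odot> y) = f x \<odot> f y)"

definition G2 :: "(octonion \<Rightarrow> octonion) monoid" where
  "G2 = \<lparr>carrier = {f. octonion_aut f}, mult = (\<circ>), one = id\<rparr>"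

text \<open>Unitality need not be required: nonzero subalgebras of the octonions contain \<open>1\<close>, being
  finite-dimensional without zero divisors.\<close>
definition M1 :: "octonion set set" where
  "M1 = {W. subspace W \<and> (\<forall>x\<in>W. \<forall>y\<in>W. x \<odot> y \<in> W) \<and> dim W = 4}"

definition M2 :: "(octonion \<times> octonion set) set" where
  "M2 = {(w, W). W \<in> M1 \<and> w \<in> W \<inter> Im_Oct \<and> w \<bullet> w = 1}"

definition M2_act ::
  "(octonion \<Rightarrow> octonion) \<Rightarrow> octonion \<times> octonion set \<Rightarrow> octonion \<times> octonion set" where
  "M2_act f = (\<lambda>(w, W)\<in>M2. (f w, f ` W))"

definition H2 :: "(octonion \<Rightarrow> octonion) set" where
  "H2 = {f \<in> carrier G2. f ` Quat \<subseteq> Quat \<and> f oct_i = oct_i}"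

section \<open>Unitary groups\<close>

definition oct_of_complex :: "complex \<Rightarrow> octonion" where
  "oct_of_complex z = Re z *\<^sub>R oct_1 + Im z *\<^sub>R oct_i"

text \<open>The subfield \<open>\<langle>1, i\<rangle>\<close> of the octonions, in which \<open>\<sigma>\<close> takes its values, is identified with the type
  \<open>complex\<close> through \<^const>\<open>oct_of_complex\<close>.\<close>
definition sigma :: "octonion \<Rightarrow> octonion \<Rightarrow> complex"  (\<open>\<sigma>\<close>) where
  "\<sigma> x y = complex_of_real (x \<bullet> y) - complex_of_real ((oct_i \<odot> x) \<bullet> y) * \<i>"

abbreviation Quat_perp :: "octonion set" where
  "Quat_perp \<equiv> orthogonal_comp Quat"

definition U_sigma :: "(octonion \<Rightarrow> octonion) monoid" where
  "U_sigma = (BijGroup Quat_perp)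
     \<lparr>carrier := {g \<in> Bij Quat_perp.
        (\<forall>x\<in>Quat_perp. \<forall>y\<in>Quat_perp. g (x + y) = g x + g y) \<and>
        (\<forall>z. \<forall>x\<in>Quat_perp. g (oct_of_complex z \<odot> x) = oct_of_complex z \<odot> g x) \<and>
        (\<forall>x\<in>Quat_perp. \<forall>y\<in>Quat_perp. \<sigma> (g x) (g y) = \<sigma> x y)}\<rparr>"

definition U2 :: "(complex^2^2) monoid" where
  "U2 = \<lparr>carrier = {A. map_matrix cnj (transpose A) ** A = mat 1}, mult = (**), one = mat 1\<rparr>"

section \<open>Oriented planes in the imaginary octonions\<close>

definition plane_bases :: "octonion set \<Rightarrow> (octonion \<times> octonion) set" where
  "plane_bases P = {(u, v). u \<noteq> v \<and> independent {u, v} \<and> span {u, v} = P}"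

definition same_orientation :: "octonion set \<Rightarrow> (octonion \<times> octonion) rel" where
  "same_orientation P = {((u, v), (u', v')).
     (u, v) \<in> plane_bases P \<and> (u', v') \<in> plane_bases P \<and>
     (\<exists>a b c d. u' = a *\<^sub>R u + b *\<^sub>R v \<and> v' = c *\<^sub>R u + d *\<^sub>R v \<and> a * d - b * c > 0)}"

text \<open>An oriented plane is a plane together with one of its two orientations, i.e. a class of ordered
  bases modulo base changes of positive determinant.\<close>
type_synonym oriented_plane = "octonion set \<times> (octonion \<times> octonion) set"

definition Gr :: "oriented_plane set" where
  "Gr = {(P, c). subspace P \<and> P \<subseteq> Im_Oct \<and> dim P = 2 \<and> c \<in> plane_bases P // same_orientation P}"

definition oriented_by :: "octonion set \<Rightarrow> octonion \<times> octonion \<Rightarrow> oriented_plane" where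
  "oriented_by P b = (P, same_orientation P `` {b})"

definition stiefel :: "(octonion \<times> octonion) set" where
  "stiefel = {(u, v). u \<in> Im_Oct \<and> v \<in> Im_Oct \<and> u \<bullet> u = 1 \<and> v \<bullet> v = 1 \<and> u \<bullet> v = 0}"

definition oriented_onb :: "oriented_plane \<Rightarrow> (octonion \<times> octonion) set" where
  "oriented_onb \<alpha> = {b \<in> stiefel. b \<in> snd \<alpha>}"

definition Gr_act :: "(octonion \<Rightarrow> octonion) \<Rightarrow> oriented_plane \<Rightarrow> oriented_plane" where
  "Gr_act f = (\<lambda>(P, c)\<in>Gr. (f ` P, map_prod f f ` c))"

definition frame_to_M2 :: "octonion \<times> octonion \<Rightarrow> octonion \<times> octonion set" where
  "frame_to_M2 = (\<lambda>(X1, X2). (X1 \<otimes>\<^sub>O X2, span {oct_1, X1, X2, X1 \<otimes>\<^sub>O X2}))"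

definition Gr_to_M2 :: "oriented_plane \<Rightarrow> octonion \<times> octonion set" where
  "Gr_to_M2 \<alpha> = frame_to_M2 (SOME b. b \<in> oriented_onb \<alpha>)"

definition M2_plane :: "octonion \<times> octonion set \<Rightarrow> octonion set" where
  "M2_plane = (\<lambda>(w, W). W \<inter> orthogonal_comp (span {oct_1, w}))"

definition M2_to_Gr :: "octonion \<times> octonion set \<Rightarrow> oriented_plane" where
  "M2_to_Gr p = (let X = (SOME X. X \<in> M2_plane p \<and> X \<bullet> X = 1)
                 in oriented_by (M2_plane p) (X, fst p \<otimes>\<^sub>O X))"

section \<open>Topologies\<close>

text \<open>
  Sets of maps \<open>octonion \<Rightarrow> octonion\<close>, in particular \<open>G2\<close> and its subgroups, carry the subspace topology
  of the library's function-space topology (pointwise convergence).  On linear maps between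
  finite-dimensional spaces this is the usual one.
\<close>

definition quotient_topology :: "'a topology \<Rightarrow> ('a \<Rightarrow> 'b) \<Rightarrow> 'b set \<Rightarrow> 'b topology" where
  "quotient_topology X \<pi> Y =
     topology (\<lambda>U. U \<subseteq> Y \<and> openin X {x \<in> topspace X. \<pi> x \<in> U})"

lemma istopology_quotient:
  "istopology (\<lambda>U. U \<subseteq> Y \<and> openin X {x \<in> topspace X. \<pi> x \<in> U})"
  unfolding istopology_def
proof (intro conjI allI impI)
  fix U V
  assume U: "U \<subseteq> Y \<and> openin X {x \<in> topspace X. \<pi> x \<in> U}"
    and V: "V \<subseteq> Y \<and> openin X {x \<in> topspace X. \<pi> x \<in> V}"
  then show "U \<inter> V \<subseteq> Y"
    by blast
  have "{x \<in> topspace X. \<pi> x \<in> U \<inter> V} = {x \<in> topspace X. \<pi> x \<in> U} \<inter> {x \<in> topspace X. \<pi> x \<in> V}"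
    by blast
  with U V show "openin X {x \<in> topspace X. \<pi> x \<in> U \<inter> V}"
    by (simp only: openin_Int)
next
  fix \<U>
  assume \<U>: "\<forall>U\<in>\<U>. U \<subseteq> Y \<and> openin X {x \<in> topspace X. \<pi> x \<in> U}"
  then show "\<Union>\<U> \<subseteq> Y"
    by blast
  have "{x \<in> topspace X. \<pi> x \<in> \<Union>\<U>} = \<Union>((\<lambda>U. {x \<in> topspace X. \<pi> x \<in> U}) ` \<U>)"
    by blast
  moreover have "openin X (\<Union>((\<lambda>U. {x \<in> topspace X. \<pi> x \<in> U}) ` \<U>))"
    using \<U> by (intro openin_Union) blast
  ultimately show "openin X {x \<in> topspace X. \<pi> x \<in> \<Union>\<U>}"
    by (simp only:)
qed

lemma openin_quotient_topology:
  "openin (quotient_topology X \<pi> Y) U \<longleftrightarrow> U \<subseteq> Y \<and> openin X {x \<in> topspace X. \<pi> x \<in> U}"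
  unfolding quotient_topology_def by (simp only: topology_inverse' [OF istopology_quotient])

lemma topspace_quotient_topology:
  assumes "\<pi> ` topspace X \<subseteq> Y"
  shows "topspace (quotient_topology X \<pi> Y) = Y"
proof (rule antisym)
  have "{x \<in> topspace X. \<pi> x \<in> Y} = topspace X"
    using assms by auto
  then show "Y \<subseteq> topspace (quotient_topology X \<pi> Y)"
    by (intro openin_subset) (simp add: openin_quotient_topology)
next
  show "topspace (quotient_topology X \<pi> Y) \<subseteq> Y"
    using openin_topspace [of "quotient_topology X \<pi> Y"]
    by (simp only: openin_quotient_topology)
qed

definition G2_mod_H2_top :: "(octonion \<Rightarrow> octonion) set topology" where
  "G2_mod_H2_top =
     quotient_topology (top_of_set (carrier G2)) (\<lambda>f. f <#\<^bsub>G2\<^esub> H2) (lcosets\<^bsub>G2\<^esub> H2)"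

definition Gr_top :: "oriented_plane topology" where
  "Gr_top = quotient_topology (top_of_set stiefel) (\<lambda>(u, v). oriented_by (span {u, v}) (u, v)) Gr"

text \<open>A linear subspace \<open>W\<close> is located in the Grassmannian by its orthogonal projection, which is
  \<^term>\<open>closest_point W\<close>.\<close>
definition M2_top :: "(octonion \<times> octonion set) topology" where
  "M2_top = pullback_topology M2 (\<lambda>(w, W). (w, closest_point W)) euclidean"

lemma topspace_M2_top: "topspace M2_top = M2"
  by (simp add: M2_top_def topspace_pullback_topology)

lemma topspace_G2_mod_H2_top: "topspace G2_mod_H2_top = lcosets\<^bsub>G2\<^esub> H2"
  unfolding G2_mod_H2_top_def
  by (rule topspace_quotient_topology) (auto simp: LCOSETS_def)

lemma stiefel_oriented_by:
  assumes "(u, v) \<in> stiefel"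
  shows "oriented_by (span {u, v}) (u, v) \<in> Gr"
proof -
  have uv: "u \<in> Im_Oct" "v \<in> Im_Oct" "u \<bullet> u = 1" "v \<bullet> v = 1" "u \<bullet> v = 0"
    using assms by (auto simp: stiefel_def)
  then have ne: "u \<noteq> v" "u \<noteq> 0" "v \<noteq> 0"
    by auto
  have indep: "independent {u, v}"
    using ne uv by (intro pairwise_orthogonal_independent)
      (auto simp: pairwise_def orthogonal_def inner_commute)
  have "span {u, v} \<subseteq> Im_Oct"
    using uv by (intro span_minimal) (auto simp: Im_Oct_def subspace_orthogonal_comp)
  moreover have "dim (span {u, v}) = 2"
    using dim_eq_card_independent [OF indep] ne by simp
  moreover have "(u, v) \<in> plane_bases (span {u, v})"
    using indep ne by (simp add: plane_bases_def)
  ultimately show ?thesis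
    by (auto simp: Gr_def oriented_by_def intro: quotientI)
qed

lemma topspace_Gr_top: "topspace Gr_top = Gr"
  unfolding Gr_top_def
  by (rule topspace_quotient_topology) (auto simp: stiefel_oriented_by)

end

(*
  A unital multiplicative linear map of the octonions preserves the norm, because it preserves the
  set of imaginary octonions, i.e. those whose square is a nonpositive real.  For an orthonormal
  imaginary pair (w, X) the span W of 1, w, X, wX is a quaternion subalgebra, and a unit u orthogonal
  to W satisfies the Cayley-Dickson rules, so i, j, l |-> w, X, u extends to an automorphism; since
  every 4-dimensional subalgebra containing w is such a W, this gives transitivity.  An automorphism
  fixing i and preserving the quaternions is determined by its restriction g to the orthogonal
  complement.  Conversely, a unitary g has the form (0, q) |-> (0, v alpha(q)) with v a unit
  quaternion and alpha a rotation of the plane <j, k>; as alpha is an automorphism of the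
  quaternions, (p, q) |-> (alpha(p), v alpha(q)) is an automorphism extending g.

  The topological statements follow from compactness: G2 (by Tychonoff) and the Stiefel manifold of
  orthonormal pairs are compact and M2 is Hausdorff, so the continuous bijections from their
  quotients onto M2 are homeomorphisms.
*)
theory Submission
  imports Defs
begin

text \<open>Octonion products of three factors cannot be rebracketed. The substitute is conj(x)(xy)
  = n(x)y with its mirror image, polarised in x and combined with the fact that multiplication by
  conj(x) is adjoint to multiplication by x.

  Both descriptions of M2 pass through one parametrisation by orthonormal pairs, (w, X) |-> (w,
  span{1, w, X, wX}). The G2-orbit of (i, H) enters it through (f(i), f(j)), and an oriented frame
  (u, v) of a plane through the cyclic shift (uv, u), because (uv)u = v. The continuity of this one
  map therefore serves both homeomorphisms. It is visible from a formula: W enters the topology of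
  M2 through its orthogonal projection, which is polynomial in w and X.

  In the comparison of H2 with the unitary groups the inverse is explicit: f(p) is recovered from
  f(pl) = f(p)f(l) by cancelling f(l), so both directions are continuous by evaluation at
  points.\<close>

lemma quaternion_cases:
  obtains a b c d :: real where "q = (a, b, c, d)"
  by (cases q) auto

lemma bilinear_qmult: "bilinear qmult"
  unfolding bilinear_def
proof (intro conjI allI linearI)
  fix p q r :: quaternion and t :: real
  show "qmult p (q + r) = qmult p q + qmult p r"
    by (cases p rule: quaternion_cases; cases q rule: quaternion_cases; cases r rule: quaternion_cases)
      (simp add: algebra_simps)
  show "qmult (q + r) p = qmult q p + qmult r p"
    by (cases p rule: quaternion_cases; cases q rule: quaternion_cases; cases r rule: quaternion_cases)
      (simp add: algebra_simps)
  show "qmult p (t *\<^sub>R q) = t *\<^sub>R qmult p q" "qmult (t *\<^sub>R q) p = t *\<^sub>R qmult q p"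
    by (cases p rule: quaternion_cases; cases q rule: quaternion_cases; simp add: algebra_simps)+
qed

interpretation qmult: bounded_bilinear qmult
  using bilinear_qmult by (simp add: bilinear_conv_bounded_bilinear)

lemma qmult_assoc: "qmult (qmult p q) r = qmult p (qmult q r)"
  by (cases p rule: quaternion_cases; cases q rule: quaternion_cases; cases r rule: quaternion_cases)
    (simp add: algebra_simps)

lemma linear_qcnj: "linear qcnj"
proof (intro linearI)
  fix p q :: quaternion and t :: real
  show "qcnj (p + q) = qcnj p + qcnj q"
    by (cases p rule: quaternion_cases; cases q rule: quaternion_cases) simp
  show "qcnj (t *\<^sub>R q) = t *\<^sub>R qcnj q"
    by (cases q rule: quaternion_cases) simp
qed

lemma qcnj_qcnj: "qcnj (qcnj q) = q"
  by (cases q rule: quaternion_cases) simp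

lemma qcnj_qmult: "qcnj (qmult p q) = qmult (qcnj q) (qcnj p)"
  by (cases p rule: quaternion_cases; cases q rule: quaternion_cases) (simp add: algebra_simps)

lemma qcnj_qmult_cancel: "qmult (qcnj p) (qmult p q) = (p \<bullet> p) *\<^sub>R q"
  by (cases p rule: quaternion_cases; cases q rule: quaternion_cases) (simp add: algebra_simps)

lemma qmult_qcnj_cancel: "qmult p (qmult (qcnj p) q) = (p \<bullet> p) *\<^sub>R q"
  by (cases p rule: quaternion_cases; cases q rule: quaternion_cases) (simp add: algebra_simps)

lemma qmult_qcnj_right: "qmult q (qmult (qcnj p) p) = (p \<bullet> p) *\<^sub>R q" "qmult q (qmult p (qcnj p)) = (p \<bullet> p) *\<^sub>R q"
  by (cases p rule: quaternion_cases; cases q rule: quaternion_cases; simp add: algebra_simps)+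

lemma inner_qmult_left: "qmult p q \<bullet> r = q \<bullet> qmult (qcnj p) r"
  by (cases p rule: quaternion_cases; cases q rule: quaternion_cases; cases r rule: quaternion_cases)
    (simp add: algebra_simps)

lemma inner_qmult_right: "qmult p q \<bullet> r = p \<bullet> qmult r (qcnj q)"
  by (cases p rule: quaternion_cases; cases q rule: quaternion_cases; cases r rule: quaternion_cases)
    (simp add: algebra_simps)

lemma inner_qcnj: "qcnj p \<bullet> q = p \<bullet> qcnj q"
  by (cases p rule: quaternion_cases; cases q rule: quaternion_cases) simp

lemmas qcnj_simps = linear_add [OF linear_qcnj] linear_diff [OF linear_qcnj]
  linear_neg [OF linear_qcnj] linear_scale [OF linear_qcnj] linear_0 [OF linear_qcnj] qcnj_qcnj qcnj_qmult

lemmas qmult_simps = qmult.add_left qmult.add_right qmult.diff_left qmult.diff_right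
  qmult.minus_left qmult.minus_right qmult.scaleR_left qmult.scaleR_right
  qmult.zero_left qmult.zero_right qmult_assoc qcnj_qmult_cancel qmult_qcnj_cancel qmult_qcnj_right

section \<open>Octonion multiplication: conjugation, adjoints, and the substitutes for
  associativity\<close>

lemma bilinear_omult: "bilinear (\<odot>)"
  unfolding bilinear_def
proof (intro conjI allI linearI)
  fix x y z :: octonion and r :: real
  show "x \<odot> (y + z) = x \<odot> y + x \<odot> z" "(y + z) \<odot> x = y \<odot> x + z \<odot> x"
    by (cases x rule: prod.exhaust; cases y rule: prod.exhaust; cases z rule: prod.exhaust; simp add: qmult_simps qcnj_simps)+
  show "x \<odot> (r *\<^sub>R y) = r *\<^sub>R (x \<odot> y)" "(r *\<^sub>R y) \<odot> x = r *\<^sub>R (y \<odot> x)"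
    by (cases x rule: prod.exhaust; cases y rule: prod.exhaust; simp add: qmult_simps qcnj_simps algebra_simps)+
qed

interpretation omult: bounded_bilinear "(\<odot>)"
  using bilinear_omult by (simp add: bilinear_conv_bounded_bilinear)

lemmas omult_simps = omult.add_left omult.add_right omult.diff_left omult.diff_right
  omult.minus_left omult.minus_right omult.scaleR_left omult.scaleR_right
  omult.zero_left omult.zero_right omult_one

lemma linear_ocnj: "linear ocnj"
proof (intro linearI)
  fix x y :: octonion and r :: real
  show "ocnj (x + y) = ocnj x + ocnj y"
    by (cases x rule: prod.exhaust; cases y rule: prod.exhaust) (simp add: qcnj_simps)
  show "ocnj (r *\<^sub>R x) = r *\<^sub>R ocnj x"
    by (cases x rule: prod.exhaust) (simp add: qcnj_simps)
qed

lemmas ocnj_simps = linear_add [OF linear_ocnj] linear_diff [OF linear_ocnj]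
  linear_neg [OF linear_ocnj] linear_scale [OF linear_ocnj] linear_0 [OF linear_ocnj]

lemma ocnj_ocnj [simp]: "ocnj (ocnj x) = x"
  by (rule octonion_cases [of x]) simp

lemma ocnj_omult: "ocnj (x \<odot> y) = ocnj y \<odot> ocnj x"
  by (cases x rule: prod.exhaust; cases y rule: prod.exhaust) (simp add: qmult_simps qcnj_simps)

lemma inner_one [simp]: "oct_1 \<bullet> oct_1 = 1"
  by (simp add: oct_1_def zero_prod_def)

lemma ocnj_eq: "ocnj x = (2 * (x \<bullet> oct_1)) *\<^sub>R oct_1 - x"
  by (rule octonion_cases [of x]) (simp add: oct_1_def zero_prod_def)

lemma ocnj_one [simp]: "ocnj oct_1 = oct_1"
  by (simp add: ocnj_eq scaleR_2)

text \<open>In quaternion pairs each of the four terms is an adjointness statement for the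
  associative quaternion product. Only the two terms in which a component of y occurs conjugated
  need preparing.\<close>

lemma inner_omult_left: "(x \<odot> y) \<bullet> z = y \<bullet> (ocnj x \<odot> z)"
proof -
  obtain p q r s t v :: quaternion where xyz: "x = (p, q)" "y = (r, s)" "z = (t, v)"
    by (metis prod.exhaust)
  have "qmult (qcnj s) q \<bullet> t = s \<bullet> qmult q (qcnj t)"
    by (metis inner_commute inner_qmult_left inner_qmult_right qcnj_qcnj)
  moreover have "qmult q (qcnj r) \<bullet> v = r \<bullet> qmult (qcnj v) q"
    by (metis inner_commute inner_qcnj inner_qmult_left qcnj_qcnj qcnj_qmult)
  ultimately show ?thesis
    by (simp add: xyz inner_diff_left inner_diff_right inner_add_left inner_add_right qmult_simps
        inner_qmult_left [of p r t] inner_qmult_right [of s p v])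
qed

lemma inner_omult_right: "(x \<odot> y) \<bullet> z = x \<bullet> (z \<odot> ocnj y)"
proof -
  obtain p q r s t v :: quaternion where xyz: "x = (p, q)" "y = (r, s)" "z = (t, v)"
    by (metis prod.exhaust)
  have "qmult (qcnj s) q \<bullet> t = q \<bullet> qmult s t" "qmult s p \<bullet> v = p \<bullet> qmult (qcnj s) v"
    "qmult q (qcnj r) \<bullet> v = q \<bullet> qmult v r"
    using inner_qmult_left [of "qcnj s" q t] inner_qmult_left [of s p v]
      inner_qmult_right [of q "qcnj r" v] by (simp_all add: qcnj_qcnj)
  then show ?thesis
    by (simp add: xyz inner_diff_left inner_diff_right inner_add_left inner_add_right qmult_simps
        qcnj_simps inner_qmult_right [of p r t])
qed

text \<open>This is the part of associativity that survives: a factor and its conjugate standing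
  next to each other. In quaternion pairs the cross terms cancel.\<close>

lemma ocnj_omult_cancel: "ocnj x \<odot> (x \<odot> y) = (x \<bullet> x) *\<^sub>R y"
  by (cases x rule: prod.exhaust; cases y rule: prod.exhaust) (simp add: qmult_simps qcnj_simps algebra_simps)

lemma omult_ocnj_cancel: "(y \<odot> x) \<odot> ocnj x = (x \<bullet> x) *\<^sub>R y"
  by (cases x rule: prod.exhaust; cases y rule: prod.exhaust) (simp add: qmult_simps qcnj_simps algebra_simps)

lemma inner_omult_omult: "(x \<odot> y) \<bullet> (x \<odot> z) = (x \<bullet> x) * (y \<bullet> z)"
  by (simp add: inner_omult_left ocnj_omult_cancel)

lemma inner_omult_omult_right: "(y \<odot> x) \<bullet> (z \<odot> x) = (x \<bullet> x) * (y \<bullet> z)"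
  by (simp add: inner_omult_right [of y x] omult_ocnj_cancel)

text \<open>Polarisation of \<open>ocnj_omult_cancel\<close> in x. For orthogonal x and z the
  right-hand side vanishes, so two left multiplications may be exchanged at the price of a sign and
  of moving the conjugation.\<close>

lemma ocnj_omult_polar: "ocnj x \<odot> (z \<odot> y) + ocnj z \<odot> (x \<odot> y) = (2 * (x \<bullet> z)) *\<^sub>R y"
  using ocnj_omult_cancel [of "x + z" y] ocnj_omult_cancel [of x y] ocnj_omult_cancel [of z y]
  by (simp add: ocnj_simps omult_simps inner_add_left inner_add_right inner_commute [of z x] algebra_simps)

text \<open>The quadratic equation of an octonion: substitute conj(x) = 2 Re(x) - x into x conj(x) =
  n(x).\<close>

lemma omult_square: "x \<odot> x = (2 * (x \<bullet> oct_1)) *\<^sub>R x - (x \<bullet> x) *\<^sub>R oct_1"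
  using omult_ocnj [of x] by (simp add: ocnj_eq omult_simps algebra_simps)

lemma mem_Im_Oct: "x \<in> Im_Oct \<longleftrightarrow> x \<bullet> oct_1 = 0"
  by (simp add: Im_Oct_def orthogonal_comp_def orthogonal_def inner_commute)

lemma ocnj_Im: "x \<in> Im_Oct \<Longrightarrow> ocnj x = - x"
  by (simp add: mem_Im_Oct ocnj_eq)

lemma omult_Im_square: "x \<in> Im_Oct \<Longrightarrow> x \<odot> x = - (x \<bullet> x) *\<^sub>R oct_1"
  by (simp add: mem_Im_Oct omult_square)

lemma inner_omult_one: "x \<in> Im_Oct \<Longrightarrow> (x \<odot> y) \<bullet> oct_1 = - (x \<bullet> y)"
  using inner_omult_left [of x y oct_1] by (simp add: omult_simps ocnj_Im inner_commute)

lemma omult_Im_cancel: "x \<in> Im_Oct \<Longrightarrow> x \<odot> (x \<odot> y) = - (x \<bullet> x) *\<^sub>R y"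
  using ocnj_omult_cancel [of x y] by (simp add: ocnj_Im omult_simps) (metis minus_equation_iff)

lemma omult_Im_cancel_right: "x \<in> Im_Oct \<Longrightarrow> (y \<odot> x) \<odot> x = - (x \<bullet> x) *\<^sub>R y"
  using omult_ocnj_cancel [of y x] by (simp add: ocnj_Im omult_simps) (metis minus_equation_iff)

lemma ocross_orthogonal: "x \<in> Im_Oct \<Longrightarrow> x \<bullet> y = 0 \<Longrightarrow> x \<otimes>\<^sub>O y = x \<odot> y"
  by (simp add: ocross_def inner_omult_one)

lemma omult_anticommute:
  assumes "x \<in> Im_Oct" "y \<in> Im_Oct" "x \<bullet> y = 0"
  shows "y \<odot> x = - (x \<odot> y)"
  using ocnj_omult_polar [of x y oct_1] assms
  by (simp add: ocnj_Im omult_simps)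

section \<open>The Cayley--Dickson extension of an orthonormal pair\<close>

text \<open>Here \<open>u\<close> plays the role of \<open>l\<close>: these are the multiplication rules of \<open>W \<oplus> W u\<close>.\<close>

lemma cayley_dickson:
  assumes W: "\<And>x y. x \<in> W \<Longrightarrow> y \<in> W \<Longrightarrow> x \<odot> y \<in> W" "\<And>x. x \<in> W \<Longrightarrow> ocnj x \<in> W" "oct_1 \<in> W"
    and u: "u \<bullet> u = 1" "\<And>x. x \<in> W \<Longrightarrow> x \<bullet> u = 0"
    and ab: "a \<in> W" "b \<in> W"
  shows "a \<odot> (b \<odot> u) = (b \<odot> a) \<odot> u"
    and "(b \<odot> u) \<odot> a = (b \<odot> ocnj a) \<odot> u"
    and "(a \<odot> u) \<odot> (b \<odot> u) = - (ocnj b \<odot> a)"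
proof -
  have uI: "u \<in> Im_Oct"
    using u(2) [OF W(3)] by (simp add: mem_Im_Oct inner_commute)
  \<comment> \<open>As x and u are orthogonal, the polarised identity applied to 1 reads
    \<open>ocnj x \<odot> u + ocnj u \<odot> x = 0\<close>, and \<open>ocnj u = - u\<close>.\<close>
  have swap: "u \<odot> x = ocnj x \<odot> u" if "x \<in> W" for x
    using ocnj_omult_polar [of x u oct_1] u(2) [OF that] by (simp add: ocnj_Im uI omult_simps)
  have 1: "a \<odot> (b \<odot> u) = (b \<odot> a) \<odot> u" if "a \<in> W" "b \<in> W" for a b
  proof -
    have "a \<odot> (b \<odot> u) = a \<odot> (u \<odot> ocnj b)"
      using swap [of "ocnj b"] W that by simp
    \<comment> \<open>The polarised identity for the orthogonal pair conj(a), u moves u to the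
      outside and conjugates a.\<close>
    also have "\<dots> = u \<odot> (ocnj a \<odot> ocnj b)"
      using ocnj_omult_polar [of "ocnj a" u "ocnj b"] u(2) [OF W(2) [OF that(1)]]
      by (simp add: ocnj_Im uI omult_simps)
    also have "\<dots> = ocnj (ocnj a \<odot> ocnj b) \<odot> u"
      using W that by (intro swap) auto
    finally show ?thesis
      by (simp add: ocnj_omult)
  qed
  show "a \<odot> (b \<odot> u) = (b \<odot> a) \<odot> u"
    by (rule 1 [OF ab])
  \<comment> \<open>The second rule is the first one conjugated: conjugation reverses products and
    sends u to -u.\<close>
  have "ocnj ((b \<odot> u) \<odot> a) = - (ocnj a \<odot> (u \<odot> ocnj b))"
    by (simp add: ocnj_omult ocnj_Im uI omult_simps)
  also have "\<dots> = - (ocnj a \<odot> (b \<odot> u))"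
    using swap [of "ocnj b"] W ab by simp
  also have "\<dots> = - ((b \<odot> ocnj a) \<odot> u)"
    using 1 [of "ocnj a" b] W ab by simp
  also have "\<dots> = - (u \<odot> ocnj (b \<odot> ocnj a))"
    using swap [of "ocnj (b \<odot> ocnj a)"] W ab by simp
  also have "\<dots> = ocnj ((b \<odot> ocnj a) \<odot> u)"
    by (simp add: ocnj_omult ocnj_Im uI omult_simps)
  finally show "(b \<odot> u) \<odot> a = (b \<odot> ocnj a) \<odot> u"
    by (metis ocnj_ocnj)
  \<comment> \<open>For the third rule, au is imaginary and orthogonal to b, so the polarised
    identity exchanges the two; then (au)u collapses to -a.\<close>
  have "(a \<odot> u) \<bullet> b = 0"
    using u(2) [of "ocnj a \<odot> b"] inner_omult_left [of a u b] W ab by (simp add: inner_commute)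
  moreover have "a \<odot> u \<in> Im_Oct"
    using u(2) [of "ocnj a"] inner_omult_left [of a u oct_1] W ab
    by (simp add: mem_Im_Oct omult_simps inner_commute)
  ultimately have "(a \<odot> u) \<odot> (b \<odot> u) = ocnj b \<odot> ((a \<odot> u) \<odot> u)"
    using ocnj_omult_polar [of "a \<odot> u" b u] 
    by (simp add: ocnj_Im omult_simps)
  also have "\<dots> = - (ocnj b \<odot> a)"
    using omult_Im_cancel_right [OF uI, of a] u by (simp add: omult_simps)
  finally show "(a \<odot> u) \<odot> (b \<odot> u) = - (ocnj b \<odot> a)" .
qed

section \<open>Automorphisms\<close>

lemma multiplicative_imp_orthogonal:
  assumes lin: "linear f" and mult: "\<And>x y. f (x \<odot> y) = f x \<odot> f y" and one: "f oct_1 = oct_1"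
  shows "orthogonal_transformation f"
proof -
  \<comment> \<open>The imaginary octonions are those with \<open>x\<^sup>2\<close> a nonpositive multiple of \<open>1\<close>.\<close>
  have Im: "f x \<bullet> oct_1 = 0 \<and> f x \<bullet> f x = x \<bullet> x" if "x \<in> Im_Oct" for x
  proof -
    have "f x \<odot> f x = - (x \<bullet> x) *\<^sub>R oct_1"
      using mult [of x x] omult_Im_square [OF that] by (simp add: linear_neg [OF lin] linear_scale [OF lin] one)
    \<comment> \<open>The square of f x is known to be -n(x); compare it with the quadratic equation
      that f x itself satisfies.\<close>
    then have eq: "(2 * (f x \<bullet> oct_1)) *\<^sub>R f x = (f x \<bullet> f x - x \<bullet> x) *\<^sub>R oct_1"
      by (simp add: omult_square algebra_simps)
    have "f x \<bullet> oct_1 = 0"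
    proof (rule ccontr)
      assume ne: "f x \<bullet> oct_1 \<noteq> 0"
      \<comment> \<open>With a nonzero real part, \<open>eq\<close> would make f x a real multiple r
        of 1. Then r^2 = -n(x), which forces r = 0 and contradicts the assumption.\<close>
      define r where "r = (f x \<bullet> f x - x \<bullet> x) / (2 * (f x \<bullet> oct_1))"
      have "f x = (1 / (2 * (f x \<bullet> oct_1))) *\<^sub>R ((2 * (f x \<bullet> oct_1)) *\<^sub>R f x)"
        using ne by simp
      then have fx: "f x = r *\<^sub>R oct_1"
        unfolding eq r_def by simp
      with \<open>f x \<odot> f x = _\<close> have "(r * r + x \<bullet> x) *\<^sub>R oct_1 = 0"
        by (simp add: omult_simps algebra_simps)
      then have "r * r + x \<bullet> x = 0"
        by (metis inner_one inner_zero_left scaleR_eq_0_iff zero_neq_one)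
      then have "r = 0"
        by (metis add_nonneg_eq_0_iff inner_ge_zero mult_eq_0_iff zero_le_square)
      with fx ne show False by simp
    qed
    with eq show ?thesis
      by (metis eq_iff_diff_eq_0 inner_one inner_zero_left mult_zero_right scaleR_eq_0_iff scaleR_zero_left zero_neq_one)
  qed
  have "f x \<bullet> f x = x \<bullet> x" for x
  proof -
    define t y where "t = x \<bullet> oct_1" and "y = x - t *\<^sub>R oct_1"
    have y: "y \<in> Im_Oct" "x = t *\<^sub>R oct_1 + y"
      by (simp_all add: y_def t_def mem_Im_Oct inner_diff_left)
    have "f x = t *\<^sub>R oct_1 + f y"
      by (simp add: y(2) linear_add [OF lin] linear_scale [OF lin] one)
    then show ?thesis
      using Im [OF y(1)] y(1)
      by (simp add: y(2) inner_add_left inner_add_right mem_Im_Oct inner_commute)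
  qed
  then show ?thesis
    using lin by (simp add: orthogonal_transformation norm_eq_sqrt_inner)
qed

text \<open>Bijectivity comes from norm preservation: an orthogonal transformation in finite
  dimension is bijective. So a construction only has to supply the algebraic identities.\<close>

lemma octonion_autI:
  assumes "linear f" "\<And>x y. f (x \<odot> y) = f x \<odot> f y" "f oct_1 = oct_1"
  shows "octonion_aut f"
  unfolding octonion_aut_def
  using assms orthogonal_transformation_bij [OF multiplicative_imp_orthogonal [OF assms]] by blast

text \<open>By surjectivity some x has f x = 1, and then 1 = f(1 x) = f(1) f(x) = f(1).\<close>

lemma octonion_aut_one: "octonion_aut f \<Longrightarrow> f oct_1 = oct_1"
  unfolding octonion_aut_def by (metis bij_pointE omult_one)

lemma octonion_aut_iff:
  "octonion_aut f \<longleftrightarrow> linear f \<and> (\<forall>x y. f (x \<odot> y) = f x \<odot> f y) \<and> f oct_1 = oct_1"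
  using octonion_autI octonion_aut_one octonion_aut_def by auto

lemma octonion_aut_linear: "octonion_aut f \<Longrightarrow> linear f"
  and octonion_aut_bij: "octonion_aut f \<Longrightarrow> bij f"
  and octonion_aut_omult: "octonion_aut f \<Longrightarrow> f (x \<odot> y) = f x \<odot> f y"
  unfolding octonion_aut_def by blast+

lemma octonion_aut_inj: "octonion_aut f \<Longrightarrow> inj f"
  by (rule bij_is_inj [OF octonion_aut_bij])

lemma octonion_aut_surj: "octonion_aut f \<Longrightarrow> surj f"
  by (rule bij_is_surj [OF octonion_aut_bij])

lemma octonion_aut_orthogonal: "octonion_aut f \<Longrightarrow> orthogonal_transformation f"
  using multiplicative_imp_orthogonal octonion_aut_iff by blast

lemma octonion_aut_inner: "octonion_aut f \<Longrightarrow> f x \<bullet> f y = x \<bullet> y"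
  using octonion_aut_orthogonal orthogonal_transformation_def by blast

lemma octonion_aut_Im: "octonion_aut f \<Longrightarrow> f x \<in> Im_Oct \<longleftrightarrow> x \<in> Im_Oct"
  by (metis mem_Im_Oct octonion_aut_inner octonion_aut_one)

lemma octonion_aut_compose: "octonion_aut f \<Longrightarrow> octonion_aut g \<Longrightarrow> octonion_aut (f \<circ> g)"
  by (simp add: octonion_aut_iff linear_compose del: split_paired_All)

lemma octonion_aut_inv:
  assumes "octonion_aut f"
  shows "octonion_aut (inv_into UNIV f)"
proof -
  have f: "linear f" "bij f" "\<And>x y. f (x \<odot> y) = f x \<odot> f y"
    using assms unfolding octonion_aut_def by blast+
  have "linear (inv_into UNIV f)"
    using f by (metis bij_betw_imp_surj inj_linear_imp_inv_linear bij_is_inj)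
  moreover have "inv_into UNIV f (x \<odot> y) = inv_into UNIV f x \<odot> inv_into UNIV f y" for x y
    using f by (metis bij_inv_eq_iff)
  ultimately show ?thesis
    using bij_imp_bij_inv [OF f(2)] unfolding octonion_aut_def by blast
qed

lemma G2_simps [simp]:
  "carrier G2 = {f. octonion_aut f}" "mult G2 = (\<circ>)" "one G2 = id"
  by (simp_all add: G2_def)

lemma group_G2: "group G2"
proof (rule groupI)
  show "\<exists>g\<in>carrier G2. g \<otimes>\<^bsub>G2\<^esub> f = \<one>\<^bsub>G2\<^esub>" if "f \<in> carrier G2" for f
    using that octonion_aut_inv [of f] by (auto simp: octonion_aut_inj intro!: bexI [of _ "inv_into UNIV f"])
qed (auto simp: octonion_aut_compose comp_assoc octonion_autI linear_id)

text \<open>Bijectivity is supplied by the group: the inverse of g acts as the inverse map.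
  Extensionality is asked for because the elements of \<open>BijGroup E\<close> are undefined
  outside E.\<close>

lemma group_actionI:
  fixes G (structure)
  assumes "group G"
    and ext: "\<And>g. g \<in> carrier G \<Longrightarrow> \<phi> g \<in> extensional E"
    and closed: "\<And>g x. g \<in> carrier G \<Longrightarrow> x \<in> E \<Longrightarrow> \<phi> g x \<in> E"
    and mult: "\<And>g h x. g \<in> carrier G \<Longrightarrow> h \<in> carrier G \<Longrightarrow> x \<in> E \<Longrightarrow> \<phi> (g \<otimes> h) x = \<phi> g (\<phi> h x)"
    and one: "\<And>x. x \<in> E \<Longrightarrow> \<phi> \<one> x = x"
  shows "group_action G E \<phi>"
proof -
  interpret group G by fact
  have Bij: "\<phi> g \<in> Bij E" if g: "g \<in> carrier G" for g
  proof -
    have "bij_betw (\<phi> g) E E"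
    proof (rule bij_betw_byWitness [where f' = "\<phi> (inv g)"])
      show "\<forall>x\<in>E. \<phi> (inv g) (\<phi> g x) = x" "\<forall>x\<in>E. \<phi> g (\<phi> (inv g) x) = x"
        using g one by (auto simp flip: mult)
    qed (use g closed in auto)
    with ext g show ?thesis by (simp add: Bij_def)
  qed
  have "\<phi> (g \<otimes> h) = compose E (\<phi> g) (\<phi> h)" if "g \<in> carrier G" "h \<in> carrier G" for g h
    using that by (intro extensionalityI [OF ext]) (auto simp: compose_def mult)
  then have "\<phi> \<in> hom G (BijGroup E)"
    using Bij by (auto simp: hom_def BijGroup_def)
  then show ?thesis
    by (intro group_action.intro group_hom.intro group_BijGroup group_axioms)
      (simp add: group_hom_axioms_def)
qed

section \<open>Quaternion subalgebras spanned by orthonormal pairs\<close>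

lemma mem_stiefel:
  "(w, X) \<in> stiefel \<longleftrightarrow> w \<in> Im_Oct \<and> X \<in> Im_Oct \<and> w \<bullet> w = 1 \<and> X \<bullet> X = 1 \<and> w \<bullet> X = 0"
  by (simp add: stiefel_def)

text \<open>For an orthonormal imaginary pair this is the algebra embedding i, j |-> w, X. Facts
  about the subalgebra spanned by 1, w, X, wX are transported along it from the quaternion
  formulas.\<close>

definition quat_embed :: "octonion \<Rightarrow> octonion \<Rightarrow> quaternion \<Rightarrow> octonion" where
  "quat_embed w X = (\<lambda>(a, b, c, d). a *\<^sub>R oct_1 + b *\<^sub>R w + c *\<^sub>R X + d *\<^sub>R (w \<odot> X))"

lemma linear_quat_embed: "linear (quat_embed w X)"
  by (intro linearI) (auto simp: quat_embed_def algebra_simps)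

lemma range_quat_embed: "range (quat_embed w X) = span {oct_1, w, X, w \<odot> X}"
proof
  show "range (quat_embed w X) \<subseteq> span {oct_1, w, X, w \<odot> X}"
  proof (rule image_subsetI)
    fix p show "quat_embed w X p \<in> span {oct_1, w, X, w \<odot> X}"
      by (cases p rule: quaternion_cases)
        (auto simp only: quat_embed_def prod.case intro!: span_add span_scale intro: span_base)
  qed
  have "oct_1 = quat_embed w X (1, 0, 0, 0)" "w = quat_embed w X (0, 1, 0, 0)"
    "X = quat_embed w X (0, 0, 1, 0)" "w \<odot> X = quat_embed w X (0, 0, 0, 1)"
    by (simp_all add: quat_embed_def)
  then have "{oct_1, w, X, w \<odot> X} \<subseteq> range (quat_embed w X)"
    by blast
  then show "span {oct_1, w, X, w \<odot> X} \<subseteq> range (quat_embed w X)"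
    by (rule span_minimal) (simp add: linear_subspace_image linear_quat_embed)
qed

text \<open>Every entry follows from the cancellation rules and the anticommutation of w and X; wX
  is imaginary because its real part is minus the inner product of w and X.\<close>

lemma stiefel_omult_table:
  assumes "(w, X) \<in> stiefel"
  shows "w \<odot> w = - oct_1" "X \<odot> X = - oct_1" "X \<odot> w = - (w \<odot> X)"
    "w \<odot> (w \<odot> X) = - X" "(w \<odot> X) \<odot> X = - w" "(w \<odot> X) \<odot> w = X" "X \<odot> (w \<odot> X) = w"
    "(w \<odot> X) \<odot> (w \<odot> X) = - oct_1" "w \<odot> X \<in> Im_Oct"
    "w \<bullet> (w \<odot> X) = 0" "X \<bullet> (w \<odot> X) = 0" "(w \<odot> X) \<bullet> (w \<odot> X) = 1"
proof -
  have wX: "w \<in> Im_Oct" "X \<in> Im_Oct" "w \<bullet> w = 1" "X \<bullet> X = 1" "w \<bullet> X = 0"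
    using assms by (auto simp: mem_stiefel)
  show ww: "w \<odot> w = - oct_1" and XX: "X \<odot> X = - oct_1"
    using wX by (simp_all add: omult_Im_square)
  show Xw: "X \<odot> w = - (w \<odot> X)"
    using wX by (simp add: omult_anticommute)
  show w1: "w \<odot> (w \<odot> X) = - X" and "(w \<odot> X) \<odot> X = - w"
    using wX by (simp_all add: omult_Im_cancel omult_Im_cancel_right)
  show "(w \<odot> X) \<odot> w = X"
    using omult_Im_cancel_right [of w X] wX Xw by (simp add: omult_simps)
  show "X \<odot> (w \<odot> X) = w"
    using omult_Im_cancel [of X w] wX Xw by (simp add: omult_simps)
  show k: "w \<odot> X \<in> Im_Oct"
    using inner_omult_one [of w X] wX by (simp add: mem_Im_Oct)
  show n: "(w \<odot> X) \<bullet> (w \<odot> X) = 1"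
    using inner_omult_omult [of w X X] wX by simp
  then show "(w \<odot> X) \<odot> (w \<odot> X) = - oct_1"
    using k by (simp add: omult_Im_square)
  show "w \<bullet> (w \<odot> X) = 0"
    using inner_omult_omult [of w oct_1 X] wX by (simp add: omult_one mem_Im_Oct inner_commute)
  show "X \<bullet> (w \<odot> X) = 0"
    using inner_omult_omult_right [of oct_1 X w] wX by (simp add: omult_one mem_Im_Oct inner_commute)
qed

lemma quat_embed_qmult:
  assumes "(w, X) \<in> stiefel"
  shows "quat_embed w X (qmult p q) = quat_embed w X p \<odot> quat_embed w X q"
  by (cases p rule: quaternion_cases; cases q rule: quaternion_cases)
    (simp add: quat_embed_def omult_simps stiefel_omult_table [OF assms] algebra_simps)

lemma quat_embed_qcnj:
  assumes "(w, X) \<in> stiefel"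
  shows "quat_embed w X (qcnj p) = ocnj (quat_embed w X p)"
  using assms stiefel_omult_table [OF assms]
  by (cases p rule: quaternion_cases)
    (simp add: quat_embed_def ocnj_simps ocnj_Im mem_stiefel)

lemma quat_span_omult:
  assumes "(w, X) \<in> stiefel" "x \<in> span {oct_1, w, X, w \<odot> X}" "y \<in> span {oct_1, w, X, w \<odot> X}"
  shows "x \<odot> y \<in> span {oct_1, w, X, w \<odot> X}"
  using assms(2,3) quat_embed_qmult [OF assms(1), symmetric]
  by (auto simp flip: range_quat_embed)

lemma quat_span_orthonormal:
  assumes "(w, X) \<in> stiefel"
  shows "pairwise orthogonal {oct_1, w, X, w \<odot> X}" "0 \<notin> {oct_1, w, X, w \<odot> X}"
    "card {oct_1, w, X, w \<odot> X} = 4"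
proof -
  have wX: "oct_1 \<bullet> w = 0" "oct_1 \<bullet> X = 0" "oct_1 \<bullet> (w \<odot> X) = 0" "w \<bullet> X = 0" "w \<bullet> (w \<odot> X) = 0"
    "X \<bullet> (w \<odot> X) = 0" "w \<bullet> w = 1" "X \<bullet> X = 1" "(w \<odot> X) \<bullet> (w \<odot> X) = 1" "oct_1 \<bullet> oct_1 = 1"
    using assms stiefel_omult_table [OF assms] by (auto simp: mem_stiefel mem_Im_Oct inner_commute)
  then show "pairwise orthogonal {oct_1, w, X, w \<odot> X}"
    by (auto simp: pairwise_insert orthogonal_def inner_commute)
  show "0 \<notin> {oct_1, w, X, w \<odot> X}"
    using wX by (metis empty_iff inner_zero_left insert_iff zero_neq_one)
  have "oct_1 \<noteq> w" "oct_1 \<noteq> X" "oct_1 \<noteq> w \<odot> X" "w \<noteq> X" "w \<noteq> w \<odot> X" "X \<noteq> w \<odot> X"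
    using wX by (metis zero_neq_one)+
  then show "card {oct_1, w, X, w \<odot> X} = 4"
    by simp
qed

lemma dim_quat_span:
  assumes "(w, X) \<in> stiefel"
  shows "dim (span {oct_1, w, X, w \<odot> X}) = 4"
  using dim_eq_card_independent [OF pairwise_orthogonal_independent]
    quat_span_orthonormal [OF assms] by (metis dim_span)

lemma quat_span_M2:
  assumes "(w, X) \<in> stiefel"
  shows "(w, span {oct_1, w, X, w \<odot> X}) \<in> M2"
  using assms quat_span_omult [OF assms] dim_quat_span [OF assms]
  by (auto simp: M2_def M1_def mem_stiefel subspace_span intro: span_base)

text \<open>Closure puts -1 = w^2 and wX into W, and the resulting 4-dimensional span already
  exhausts W.\<close>

lemma M1_eq_quat_span:
  assumes "W \<in> M1" "(w, X) \<in> stiefel" "w \<in> W" "X \<in> W"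
  shows "W = span {oct_1, w, X, w \<odot> X}"
proof -
  have W: "subspace W" "\<And>x y. x \<in> W \<Longrightarrow> y \<in> W \<Longrightarrow> x \<odot> y \<in> W" "dim W = 4"
    using assms(1) by (auto simp: M1_def)
  have "- oct_1 \<in> W"
    using W(2) [OF assms(3,3)] stiefel_omult_table [OF assms(2)] by simp
  then have "oct_1 \<in> W"
    using subspace_neg [OF W(1)] by fastforce
  then have "{oct_1, w, X, w \<odot> X} \<subseteq> W"
    using assms W(2) by auto
  then have "span {oct_1, w, X, w \<odot> X} \<subseteq> W"
    using W(1) by (rule span_minimal)
  then show ?thesis
    using W dim_quat_span [OF assms(2)] by (metis order_refl subspace_dim_equal subspace_span)
qed

text \<open>The vectors 1 and w span at most two of the four dimensions of W, which leaves a unit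
  vector of W orthogonal to both.\<close>

lemma M2_frame_exists:
  assumes "(w, W) \<in> M2"
  obtains X where "X \<in> W" "(w, X) \<in> stiefel"
proof -
  have W: "subspace W" "dim W = 4" "w \<in> W" "w \<in> Im_Oct" "w \<bullet> w = 1"
    "\<And>x y. x \<in> W \<Longrightarrow> y \<in> W \<Longrightarrow> x \<odot> y \<in> W"
    using assms by (auto simp: M2_def M1_def)
  have "- oct_1 \<in> W"
    using W(6) [OF W(3,3)] W by (simp add: omult_Im_square)
  then have "oct_1 \<in> W"
    using subspace_neg [OF W(1)] by fastforce
  then have "span {oct_1, w} \<subseteq> W"
    using W by (intro span_minimal) auto
  moreover have "dim (span {oct_1, w}) \<le> card {oct_1, w}"
    by (simp add: dim_le_card')
  then have "dim (span {oct_1, w}) < dim W"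
    using card_insert_le_m1 [of 2 "{w}" oct_1] W by (simp add: card_insert_if split: if_splits)
  ultimately have "span {oct_1, w} \<subset> span W"
    using W(1) by (metis dim_span nless_le psubsetI span_eq_iff)
  then obtain x where x: "x \<noteq> 0" "x \<in> span W" "\<And>y. y \<in> span {oct_1, w} \<Longrightarrow> orthogonal x y"
    using orthogonal_to_subspace_exists_gen by blast
  define X where "X = x /\<^sub>R norm x"
  have "X \<in> W"
    using x W(1) by (metis X_def span_eq_iff subspace_scale)
  moreover have "x \<bullet> oct_1 = 0" "x \<bullet> w = 0"
    using x(3) by (auto simp: orthogonal_def span_base)
  moreover have "X \<bullet> X = 1"
    using x(1) by (simp add: X_def dot_square_norm power2_eq_square)
  ultimately show thesis
    using W by (intro that) (auto simp: mem_stiefel mem_Im_Oct X_def inner_commute)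
qed

section \<open>Transitivity\<close>

lemma frame_extends:
  assumes "(w, X) \<in> stiefel"
  obtains f where "octonion_aut f" "f oct_i = w" "f oct_j = X" "f oct_k = w \<odot> X"
proof -
  let ?W = "span {oct_1, w, X, w \<odot> X}"
  let ?\<phi> = "quat_embed w X"
  \<comment> \<open>The span fills 4 of 8 dimensions, so a unit u orthogonal to it exists; it will
    be the image of l.\<close>
  have "dim {oct_1, w, X, w \<odot> X} < DIM(octonion)"
    using dim_quat_span [OF assms] by simp
  then obtain x where x: "x \<noteq> 0" "\<And>y. y \<in> ?W \<Longrightarrow> orthogonal x y"
    using orthogonal_to_subspace_exists by blast
  define u where "u = x /\<^sub>R norm x"
  have u: "u \<bullet> u = 1" "\<And>y. y \<in> ?W \<Longrightarrow> y \<bullet> u = 0"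
    using x by (auto simp: u_def dot_square_norm power2_eq_square orthogonal_def inner_commute)
  \<comment> \<open>This is p + q l |-> \<phi>(p) + \<phi>(q) u. Its multiplicativity is the product
    formula for pairs matched against the rules \<open>CD\<close>.\<close>
  define f where "f = (\<lambda>x. ?\<phi> (fst x) + ?\<phi> (snd x) \<odot> u)"
  have \<phi>W: "?\<phi> p \<in> ?W" for p
    by (auto simp flip: range_quat_embed)
  have cW: "ocnj y \<in> ?W" if "y \<in> ?W" for y
    using that quat_embed_qcnj [OF assms, symmetric] by (auto simp flip: range_quat_embed)
  have oneW: "oct_1 \<in> ?W"
    by (simp add: span_base)
  note \<phi>_simps = linear_add [OF linear_quat_embed] linear_diff [OF linear_quat_embed]
    linear_scale [OF linear_quat_embed] linear_0 [OF linear_quat_embed]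
  note CD = cayley_dickson [OF quat_span_omult [OF assms] cW oneW u \<phi>W \<phi>W]
  have "linear f"
    by (intro linearI) (simp_all add: f_def \<phi>_simps omult_simps algebra_simps)
  moreover have "f (x \<odot> y) = f x \<odot> f y" for x y
  proof -
    obtain p q r s :: quaternion where xy: "x = (p, q)" "y = (r, s)"
      by (metis prod.exhaust)
    show ?thesis
      by (simp add: xy f_def \<phi>_simps omult_simps CD quat_embed_qmult [OF assms] quat_embed_qcnj [OF assms]
          algebra_simps)
  qed
  moreover have f: "f oct_1 = oct_1" "f oct_i = w" "f oct_j = X" "f oct_k = w \<odot> X"
    by (simp_all add: f_def oct_1_def oct_i_def oct_j_def oct_k_def \<phi>_simps omult_simps)
      (simp_all add: quat_embed_def oct_1_def zero_prod_def)
  ultimately show thesis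
    using octonion_autI that by blast
qed

lemma stiefel_ij: "(oct_i, oct_j) \<in> stiefel"
  by (simp add: mem_stiefel mem_Im_Oct oct_1_def oct_i_def oct_j_def zero_prod_def)

lemma Quat_eq_quat_span: "Quat = span {oct_1, oct_i, oct_j, oct_i \<odot> oct_j}"
  by (simp add: Quat_def quaternion_table)

lemma base_M2: "(oct_i, Quat) \<in> M2"
  unfolding Quat_eq_quat_span by (rule quat_span_M2 [OF stiefel_ij])

lemma octonion_aut_M2:
  assumes "octonion_aut f" "(w, W) \<in> M2"
  shows "(f w, f ` W) \<in> M2"
proof -
  have f: "linear f" "inj f" "\<And>x y. f (x \<odot> y) = f x \<odot> f y"
    using assms(1) by (auto simp: octonion_aut_linear octonion_aut_inj octonion_aut_omult)
  have "dim (f ` W) = dim W"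
    using f by (meson dim_image_eq inj_on_subset subset_UNIV)
  moreover have "f x \<odot> f y \<in> f ` W" if "x \<in> W" "y \<in> W" for x y
    using that assms(2) by (auto simp: M2_def M1_def simp flip: f(3))
  ultimately show ?thesis
    using assms f by (auto simp: M2_def M1_def octonion_aut_Im octonion_aut_inner linear_subspace_image)
qed

lemma group_action_M2: "group_action G2 M2 M2_act"
proof (rule group_actionI [OF group_G2])
  show "M2_act f p \<in> M2" if "f \<in> carrier G2" "p \<in> M2" for f p
    using that octonion_aut_M2 by (cases p rule: prod.exhaust) (auto simp: M2_act_def)
  show "M2_act (f \<otimes>\<^bsub>G2\<^esub> g) p = M2_act f (M2_act g p)"
    if "f \<in> carrier G2" "g \<in> carrier G2" "p \<in> M2" for f g p
    using that octonion_aut_M2 by (cases p rule: prod.exhaust) (auto simp: M2_act_def image_comp)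
qed (auto simp: M2_act_def)

lemma M2_reachable:
  assumes "p \<in> M2"
  shows "\<exists>f\<in>carrier G2. M2_act f (oct_i, Quat) = p"
proof -
  obtain w W where p: "p = (w, W)"
    by (metis prod.exhaust)
  with assms have wW: "(w, W) \<in> M2" "W \<in> M1" "w \<in> W"
    by (auto simp: M2_def)
  then obtain X where X: "X \<in> W" "(w, X) \<in> stiefel"
    using M2_frame_exists by blast
  then obtain f where f: "octonion_aut f" "f oct_i = w" "f oct_j = X" "f oct_k = w \<odot> X"
    using frame_extends by blast
  have "f ` Quat = span (f ` {oct_1, oct_i, oct_j, oct_k})"
    unfolding Quat_def by (rule linear_span_image [OF octonion_aut_linear [OF f(1)], symmetric])
  also have "\<dots> = W"
    using f octonion_aut_one [OF f(1)] M1_eq_quat_span [OF wW(2) X(2) wW(3) X(1)] by simp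
  finally show ?thesis
    using f base_M2 by (auto simp: M2_act_def p)
qed

lemma transitive_action_M2: "transitive_action G2 M2 M2_act"
proof -
  interpret group_action G2 M2 M2_act
    by (rule group_action_M2)
  show ?thesis
  proof
    fix p q assume "p \<in> M2" "q \<in> M2"
    then obtain f g where fg: "f \<in> carrier G2" "M2_act f (oct_i, Quat) = p"
      "g \<in> carrier G2" "M2_act g (oct_i, Quat) = q"
      using M2_reachable by metis
    have "M2_act (inv\<^bsub>G2\<^esub> f) p = (oct_i, Quat)"
      using orbit_sym_aux [OF fg(1) base_M2 fg(2)] .
    then have "M2_act (g \<otimes>\<^bsub>G2\<^esub> inv\<^bsub>G2\<^esub> f) p = q"
      using fg \<open>p \<in> M2\<close> composition_rule [OF \<open>p \<in> M2\<close> fg(3), of "inv\<^bsub>G2\<^esub> f"] group.inv_closed [OF group_G2 fg(1)]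
      by simp
    then show "\<exists>h\<in>carrier G2. M2_act h p = q"
      using monoid.m_closed [OF group.is_monoid [OF group_G2] fg(3) group.inv_closed [OF group_G2 fg(1)]]
      by (rule bexI)
  qed
qed

lemma stabilizer_M2: "stabilizer G2 M2_act (oct_i, Quat) = H2"
proof -
  have "f ` Quat = Quat" if "octonion_aut f" "f ` Quat \<subseteq> Quat" for f
  proof (rule subspace_dim_equal)
    have "linear f" "inj f"
      using that octonion_aut_linear octonion_aut_inj by blast+
    then show "subspace (f ` Quat)"
      by (simp add: Quat_def linear_subspace_image)
    have "dim (f ` Quat) = dim Quat"
      by (rule dim_image_eq) (use \<open>linear f\<close> \<open>inj f\<close> inj_on_subset in auto)
    then show "dim Quat \<le> dim (f ` Quat)"
      by simp
  qed (use that in \<open>simp_all add: Quat_def\<close>)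
  then show ?thesis
    using base_M2 by (auto simp: stabilizer_def H2_def M2_act_def)
qed

section \<open>The stabilizer as a unitary group\<close>

lemma homeomorphic_map_top_of_setI:
  assumes "continuous_on S f" "continuous_on T g"
    and "\<And>x. x \<in> S \<Longrightarrow> f x \<in> T \<and> g (f x) = x" "\<And>y. y \<in> T \<Longrightarrow> g y \<in> S \<and> f (g y) = y"
  shows "homeomorphic_map (top_of_set S) (top_of_set T) f" "bij_betw f S T"
proof -
  have "homeomorphic_maps (top_of_set S) (top_of_set T) f g"
    using assms by (auto simp: homeomorphic_maps_def)
  then show "homeomorphic_map (top_of_set S) (top_of_set T) f"
    by (rule homeomorphic_maps_imp_map)
  show "bij_betw f S T"
    using assms by (intro bij_betw_byWitness [where f' = g]) auto
qed

lemma Quat_eq: "Quat = range (\<lambda>p. (p, 0))"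
proof -
  have "quat_embed oct_i oct_j p = (p, 0)" for p
    by (cases p rule: quaternion_cases)
      (simp add: quat_embed_def quaternion_table oct_1_def oct_i_def oct_j_def oct_k_def
        zero_prod_def)
  then show ?thesis
    unfolding Quat_eq_quat_span range_quat_embed [symmetric] by simp
qed

lemma mem_Quat_perp: "x \<in> Quat_perp \<longleftrightarrow> fst x = 0"
proof (cases x rule: prod.exhaust)
  case (Pair p q)
  have "x \<in> Quat_perp \<longleftrightarrow> (\<forall>r. r \<bullet> p = 0)"
    unfolding Quat_eq orthogonal_comp_def orthogonal_def Pair by simp
  also have "\<dots> \<longleftrightarrow> p = 0"
    by (metis inner_eq_zero_iff inner_zero_right)
  finally show ?thesis
    by (simp add: Pair)
qed

lemma zero_Pair_Quat_perp: "(0, q) \<in> Quat_perp"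
  by (simp add: mem_Quat_perp)

lemma Quat_perp_cases:
  assumes "x \<in> Quat_perp"
  obtains q where "x = (0, q)"
  using assms by (metis mem_Quat_perp prod.collapse)

text \<open>By q1(q2 l) = (q2 q1) l the left action of the complex numbers is a right quaternion
  multiplication. Hence it commutes with left multiplication by a quaternion.\<close>

lemma oct_of_complex_omult_perp: "oct_of_complex z \<odot> (0, q) = (0, qmult q (Re z, Im z, 0, 0))"
  by (cases q rule: quaternion_cases)
    (simp add: oct_of_complex_def oct_1_def oct_i_def zero_prod_def)

lemma oct_of_complex_i: "oct_of_complex \<i> = oct_i"
  by (simp add: oct_of_complex_def)

lemma Re_sigma: "Re (\<sigma> x y) = x \<bullet> y"
  by (simp add: sigma_def)

lemma mem_U_sigma:
  "g \<in> carrier U_sigma \<longleftrightarrow> g \<in> Bij Quat_perp \<and>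
     (\<forall>x\<in>Quat_perp. \<forall>y\<in>Quat_perp. g (x + y) = g x + g y) \<and>
     (\<forall>z. \<forall>x\<in>Quat_perp. g (oct_of_complex z \<odot> x) = oct_of_complex z \<odot> g x) \<and>
     (\<forall>x\<in>Quat_perp. \<forall>y\<in>Quat_perp. \<sigma> (g x) (g y) = \<sigma> x y)"
  by (simp add: U_sigma_def)

lemma mult_U_sigma:
  "g \<in> carrier U_sigma \<Longrightarrow> h \<in> carrier U_sigma \<Longrightarrow> g \<otimes>\<^bsub>U_sigma\<^esub> h = compose Quat_perp g h"
  by (simp add: mem_U_sigma del: split_paired_All) (simp add: U_sigma_def BijGroup_def)

lemma U_sigma_D:
  assumes "g \<in> carrier U_sigma"
  shows "g \<in> Bij Quat_perp" "g \<in> extensional Quat_perp"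
    "x \<in> Quat_perp \<Longrightarrow> g x \<in> Quat_perp"
    "x \<in> Quat_perp \<Longrightarrow> y \<in> Quat_perp \<Longrightarrow> g (x + y) = g x + g y"
    "x \<in> Quat_perp \<Longrightarrow> g (oct_of_complex z \<odot> x) = oct_of_complex z \<odot> g x"
    "x \<in> Quat_perp \<Longrightarrow> y \<in> Quat_perp \<Longrightarrow> \<sigma> (g x) (g y) = \<sigma> x y"
proof -
  note g = assms [unfolded mem_U_sigma]
  show Bij: "g \<in> Bij Quat_perp"
    using g by (rule conjunct1)
  show "g \<in> extensional Quat_perp" "x \<in> Quat_perp \<Longrightarrow> g x \<in> Quat_perp"
    using Bij_imp_extensional [OF Bij] funcset_mem [OF Bij_imp_funcset [OF Bij]] by blast+
  show "x \<in> Quat_perp \<Longrightarrow> y \<in> Quat_perp \<Longrightarrow> g (x + y) = g x + g y"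
    "x \<in> Quat_perp \<Longrightarrow> g (oct_of_complex z \<odot> x) = oct_of_complex z \<odot> g x"
    "x \<in> Quat_perp \<Longrightarrow> y \<in> Quat_perp \<Longrightarrow> \<sigma> (g x) (g y) = \<sigma> x y"
    using g by blast+
qed

lemma H2_D:
  assumes "f \<in> H2"
  shows "octonion_aut f" "f ` Quat = Quat" "f oct_i = oct_i"
  using assms base_M2 unfolding stabilizer_M2 [symmetric]
  by (auto simp: stabilizer_def M2_act_def)

text \<open>As f maps \<open>Quat\<close> onto itself, orthogonality of f x to \<open>Quat\<close>
  can be tested against the vectors f y.\<close>

lemma H2_Quat_perp:
  assumes "f \<in> H2"
  shows "f x \<in> Quat_perp \<longleftrightarrow> x \<in> Quat_perp"
proof -
  have "f x \<in> Quat_perp \<longleftrightarrow> (\<forall>y\<in>Quat. f y \<bullet> f x = 0)"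
    by (subst H2_D(2) [OF assms, symmetric]) (simp add: orthogonal_comp_def orthogonal_def)
  also have "\<dots> \<longleftrightarrow> x \<in> Quat_perp"
    using octonion_aut_inner [OF H2_D(1) [OF assms]] by (simp add: orthogonal_comp_def orthogonal_def)
  finally show ?thesis .
qed

text \<open>Since f fixes 1 and i, it fixes the whole subfield \<langle>1, i\<rangle>, and
  multiplicativity becomes complex linearity. The form \<sigma> is built from the inner product and
  left multiplication by i, and f respects both.\<close>

lemma restrict_H2:
  assumes "f \<in> H2"
  shows "restrict f Quat_perp \<in> carrier U_sigma"
proof -
  note f = H2_D [OF assms]
  have "f ` Quat_perp = Quat_perp"
  proof (intro subset_antisym subsetI)
    fix y assume "y \<in> Quat_perp"
    moreover obtain x where "y = f x"
      using f(1) unfolding octonion_aut_def by (metis bij_pointE)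
    ultimately show "y \<in> f ` Quat_perp"
      using H2_Quat_perp [OF assms] by blast
  qed (use H2_Quat_perp [OF assms] in blast)
  then have "bij_betw (restrict f Quat_perp) Quat_perp Quat_perp"
    using inj_on_subset [OF octonion_aut_inj [OF f(1)] subset_UNIV] by (simp add: bij_betw_def)
  moreover have "oct_of_complex z \<odot> x \<in> Quat_perp" if "x \<in> Quat_perp" for z x
    using that by (auto elim!: Quat_perp_cases simp: oct_of_complex_omult_perp zero_Pair_Quat_perp)
  moreover have "f (oct_of_complex z) = oct_of_complex z" for z
    using f by (simp add: oct_of_complex_def linear_add [OF octonion_aut_linear]
        linear_scale [OF octonion_aut_linear] octonion_aut_one)
  moreover have "\<sigma> (f x) (f y) = \<sigma> x y" for x y
    using octonion_aut_inner [OF f(1)] octonion_aut_omult [OF f(1), of oct_i x] f(3)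
    by (metis sigma_def)
  ultimately show ?thesis
    unfolding mem_U_sigma
    using subspace_add [OF subspace_orthogonal_comp [of Quat]]
    by (simp add: Bij_def linear_add [OF octonion_aut_linear [OF f(1)]] octonion_aut_omult [OF f(1)]
        del: split_paired_All)
qed

text \<open>Conjugation of \<open>a + b i + c j + d k\<close> by a unit of \<open>\<langle>1, i\<rangle>\<close> rotates the plane \<open>\<langle>j, k\<rangle>\<close>.\<close>
definition jk_rot :: "real \<Rightarrow> real \<Rightarrow> quaternion \<Rightarrow> quaternion" where
  "jk_rot x y = (\<lambda>(a, b, c, d). (a, b, x * c - y * d, x * d + y * c))"

lemma linear_jk_rot: "linear (jk_rot x y)"
  by (intro linearI) (auto simp: jk_rot_def algebra_simps)

lemma jk_rot_qcnj: "jk_rot x y (qcnj p) = qcnj (jk_rot x y p)"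
  by (cases p rule: quaternion_cases) (simp add: jk_rot_def)

lemma jk_rot_qmult:
  assumes "x * x + y * y = 1"
  shows "jk_rot x y (qmult p q) = qmult (jk_rot x y p) (jk_rot x y q)"
proof (cases p rule: quaternion_cases; cases q rule: quaternion_cases)
  fix a b c d a' b' c' d' assume pq: "p = (a, b, c, d)" "q = (a', b', c', d')"
  \<comment> \<open>Products of two components from \<langle>j, k\<rangle> acquire the factor x^2 +
    y^2 on the right-hand side; inserting this factor on the left turns the claim into a polynomial
    identity.\<close>
  have "c * c' = (x * x + y * y) * (c * c')" "d * d' = (x * x + y * y) * (d * d')"
    "c * d' = (x * x + y * y) * (c * d')" "d * c' = (x * x + y * y) * (d * c')"
    using assms by simp_all
  then show ?thesis
    by (simp add: pq jk_rot_def algebra_simps)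
qed

text \<open>In the second component g is right linear over \<langle>1, i\<rangle>, hence determined
  by its values at 1 and j. With the value v at 1 factored out on the left, the value at j is v s,
  where s is a unit orthogonal to \<langle>1, i\<rangle>, that is, s = x j + y k.\<close>

lemma U_sigma_normal_form:
  assumes "g \<in> carrier U_sigma"
  obtains v x y where "v \<bullet> v = 1" "x * x + y * y = 1" "\<And>q. g (0, q) = (0, qmult v (jk_rot x y q))"
proof -
  note g = U_sigma_D [OF assms]
  define \<gamma> where "\<gamma> q = snd (g (0, q))" for q
  have g\<gamma>: "g (0, q) = (0, \<gamma> q)" for q
    using g(3) [OF zero_Pair_Quat_perp] unfolding \<gamma>_def mem_Quat_perp by (metis prod.collapse)
  have add: "\<gamma> (p + q) = \<gamma> p + \<gamma> q" for p q
    using g(4) [OF zero_Pair_Quat_perp zero_Pair_Quat_perp, of p q] by (simp add: g\<gamma>)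
  have cmult: "\<gamma> (qmult q (a, b, 0, 0)) = qmult (\<gamma> q) (a, b, 0, 0)" for q a b
    using g(5) [OF zero_Pair_Quat_perp [of q], of "Complex a b"] by (simp add: g\<gamma> oct_of_complex_omult_perp)
  have inn: "\<gamma> p \<bullet> \<gamma> q = p \<bullet> q" for p q
    using arg_cong [OF g(6) [OF zero_Pair_Quat_perp zero_Pair_Quat_perp], of Re p q]
    by (simp add: g\<gamma> Re_sigma)
  define v where "v = \<gamma> (1, 0, 0, 0)"
  define s where "s = qmult (qcnj v) (\<gamma> (0, 0, 1, 0))"
  have v: "v \<bullet> v = 1"
    by (simp add: v_def inn)
  have vs: "\<gamma> (0, 0, 1, 0) = qmult v s"
    by (simp add: s_def qmult_qcnj_cancel v)
  have "s \<bullet> s = 1"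
    using inn [of "(0, 0, 1, 0)" "(0, 0, 1, 0)"]
    by (simp add: vs inner_qmult_left [of v] qcnj_qmult_cancel v)
  \<comment> \<open>By complex linearity v(a + b i) is the image of a + b i, which is orthogonal to
    j; left multiplication by the unit v is an isometry.\<close>
  moreover have s_orth: "s \<bullet> (a, b, 0, 0) = 0" for a b
  proof -
    have "qmult v s \<bullet> qmult v (a, b, 0, 0) = (0, 0, 1, 0) \<bullet> (a, b, 0::real, 0::real)"
      using inn [of "(0, 0, 1, 0)" "qmult (1, 0, 0, 0) (a, b, 0, 0)"] unfolding vs cmult v_def by simp
    then show ?thesis
      by (simp add: inner_qmult_left [of v] qcnj_qmult_cancel v)
  qed
  moreover obtain t u x y where s: "s = (t, u, x, y)"
    by (cases s rule: quaternion_cases)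
  ultimately have xy: "x * x + y * y = 1" "s = (0, 0, x, y)"
    using s_orth [of 1 0] s_orth [of 0 1] by auto
  have "\<gamma> q = qmult v (jk_rot x y q)" for q
  proof (cases q rule: quaternion_cases)
    fix a b c d assume q: "q = (a, b, c, d)"
    \<comment> \<open>Here a + b i + c j + d k = (a + b i) + j(c - d i), the expansion in the right
      complex basis 1, j.\<close>
    have "\<gamma> q = \<gamma> (qmult (1, 0, 0, 0) (a, b, 0, 0) + qmult (0, 0, 1, 0) (c, - d, 0, 0))"
      by (simp add: q)
    also have "\<dots> = qmult v (a, b, 0, 0) + qmult (qmult v s) (c, - d, 0, 0)"
      unfolding add cmult vs v_def ..
    also have "\<dots> = qmult v ((a, b, 0, 0) + qmult s (c, - d, 0, 0))"
      by (simp only: qmult_assoc qmult.add_right)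
    also have "(a, b, 0, 0) + qmult s (c, - d, 0, 0) = jk_rot x y q"
      by (simp add: xy q jk_rot_def)
    finally show ?thesis .
  qed
  then show thesis
    using that v xy(1) g\<gamma> by metis
qed

text \<open>Since \<open>(p, 0) l = (0, p)\<close>, an automorphism is determined by its values on \<open>Quat_perp\<close>.\<close>
definition aut_of_perp :: "(octonion \<Rightarrow> octonion) \<Rightarrow> octonion \<Rightarrow> octonion" where
  "aut_of_perp g x = g (0, fst x) \<odot> ocnj (g oct_l) + g (0, snd x)"

text \<open>In f(pl) = f(p) f(l) the factor f(l) is a unit, so right multiplication by its conjugate
  recovers f(p).\<close>

lemma aut_of_perp_restrict:
  assumes "f \<in> H2"
  shows "aut_of_perp (restrict f Quat_perp) = f"
proof
  fix x :: octonion
  note f = H2_D(1) [OF assms]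
  have l: "oct_l \<in> Quat_perp" "oct_l \<bullet> oct_l = 1"
    by (simp_all add: oct_l_def mem_Quat_perp)
  have "f (0, fst x) = f (fst x, 0) \<odot> f oct_l"
    using octonion_rules(1) [of "fst x"] octonion_aut_omult [OF f] by metis
  then have "f (0, fst x) \<odot> ocnj (f oct_l) = f (fst x, 0)"
    by (simp add: omult_ocnj_cancel octonion_aut_inner [OF f] l)
  then have "aut_of_perp f x = f ((fst x, 0) + (0, snd x))"
    unfolding aut_of_perp_def by (simp only: linear_add [OF octonion_aut_linear [OF f]])
  also have "aut_of_perp f x = aut_of_perp (restrict f Quat_perp) x"
    by (simp add: aut_of_perp_def l zero_Pair_Quat_perp)
  finally show "aut_of_perp (restrict f Quat_perp) x = f x"
    by simp
qed

lemma aut_of_perp_U_sigma: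
  assumes "g \<in> carrier U_sigma"
  shows "aut_of_perp g \<in> H2" "restrict (aut_of_perp g) Quat_perp = g"
proof -
  obtain v x y where v: "v \<bullet> v = 1" and xy: "x * x + y * y = 1"
    and g: "\<And>q. g (0, q) = (0, qmult v (jk_rot x y q))"
    using U_sigma_normal_form [OF assms] by blast
  note rot_simps = linear_add [OF linear_jk_rot] linear_diff [OF linear_jk_rot]
    linear_scale [OF linear_jk_rot] linear_0 [OF linear_jk_rot]
    jk_rot_qmult [OF xy] jk_rot_qcnj
  have "qmult v (1, 0, 0, 0) = v"
    by (cases v rule: quaternion_cases) simp
  then have gl: "g oct_l = (0, v)"
    by (simp add: oct_l_def g jk_rot_def)
  \<comment> \<open>In the first component v disappears because conj(v) v = 1; only the rotation is
    left.\<close>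
  have f: "aut_of_perp g = (\<lambda>z. (jk_rot x y (fst z), qmult v (jk_rot x y (snd z))))"
    by (rule ext) (simp add: aut_of_perp_def gl g qmult_simps qcnj_simps v)
  have "octonion_aut (aut_of_perp g)"
    unfolding f
  proof (rule octonion_autI)
    fix z w :: octonion
    obtain p q r s where "z = (p, q)" "w = (r, s)"
      by (metis prod.exhaust)
    then show "(jk_rot x y (fst (z \<odot> w)), qmult v (jk_rot x y (snd (z \<odot> w)))) =
      (jk_rot x y (fst z), qmult v (jk_rot x y (snd z))) \<odot> (jk_rot x y (fst w), qmult v (jk_rot x y (snd w)))"
      by (simp add: rot_simps qmult_simps qcnj_simps v)
  qed (intro linearI, simp_all add: rot_simps qmult_simps oct_1_def, simp add: jk_rot_def)
  moreover have "aut_of_perp g oct_i = oct_i" "aut_of_perp g ` Quat \<subseteq> Quat"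
    by (auto simp: f Quat_eq oct_i_def rot_simps qmult_simps) (simp add: jk_rot_def)
  ultimately show "aut_of_perp g \<in> H2"
    by (simp add: H2_def)
  show "restrict (aut_of_perp g) Quat_perp = g"
    by (intro extensionalityI [OF restrict_extensional U_sigma_D(2) [OF assms]])
      (auto elim!: Quat_perp_cases simp: f g rot_simps zero_Pair_Quat_perp)
qed

lemma continuous_on_eval: "continuous_on S (\<lambda>f. f x)"
  by (rule continuous_on_subset [OF continuous_on_product_coordinates]) simp

lemma continuous_on_linear_compose:
  fixes g :: "'a::euclidean_space \<Rightarrow> 'b::real_normed_vector"
  assumes "linear g" "continuous_on S f"
  shows "continuous_on S (\<lambda>x. g (f x))"
  using assms by (simp add: bounded_linear.continuous_on linear_conv_bounded_linear)

text \<open>In the topology of pointwise convergence continuity is tested one argument at a time.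
  Each value of the restriction is an evaluation or, off \<open>Quat_perp\<close>, the constant
  \<open>undefined\<close>; each value of the inverse is built from evaluations by octonion
  operations.\<close>

lemma restrict_H2_homeomorphic:
  "homeomorphic_map (top_of_set H2) (top_of_set (carrier U_sigma)) (\<lambda>f. restrict f Quat_perp)"
  and restrict_H2_bij: "bij_betw (\<lambda>f. restrict f Quat_perp) H2 (carrier U_sigma)"
proof -
  have 1: "continuous_on H2 (\<lambda>f. restrict f Quat_perp)"
  proof (intro continuous_on_coordinatewise_then_product)
    show "continuous_on H2 (\<lambda>f. restrict f Quat_perp x)" for x
      by (cases "x \<in> Quat_perp") (simp_all add: continuous_on_eval)
  qed
  have 2: "continuous_on (carrier U_sigma) aut_of_perp"
  proof (intro continuous_on_coordinatewise_then_product)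
    show "continuous_on (carrier U_sigma) (\<lambda>g. aut_of_perp g x)" for x
      unfolding aut_of_perp_def
      by (intro continuous_on_add omult.continuous_on continuous_on_linear_compose [OF linear_ocnj]
          continuous_on_eval)
  qed
  show "homeomorphic_map (top_of_set H2) (top_of_set (carrier U_sigma)) (\<lambda>f. restrict f Quat_perp)"
    "bij_betw (\<lambda>f. restrict f Quat_perp) H2 (carrier U_sigma)"
    using homeomorphic_map_top_of_setI [OF 1 2]
    by (simp_all add: aut_of_perp_restrict aut_of_perp_U_sigma restrict_H2)
qed

lemma restrict_H2_iso: "(\<lambda>f. restrict f Quat_perp) \<in> iso (G2\<lparr>carrier := H2\<rparr>) U_sigma"
proof -
  have "restrict (f \<circ> g) Quat_perp = restrict f Quat_perp \<otimes>\<^bsub>U_sigma\<^esub> restrict g Quat_perp"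
    if "f \<in> H2" "g \<in> H2" for f g
    using that H2_Quat_perp [OF that(2)] by (auto simp: mult_U_sigma restrict_H2 compose_def)
  then show ?thesis
    using restrict_H2_bij restrict_H2 by (auto simp: iso_def hom_def)
qed

section \<open>Coordinates on \<open>Quat_perp\<close>\<close>

text \<open>The complex structure of \<open>Quat_perp\<close> is right multiplication of the second component by \<open>\<langle>1, i\<rangle>\<close>,
  and \<open>q = z\<^sub>1 + j z\<^sub>2\<close> has coordinates \<open>(z\<^sub>1, z\<^sub>2)\<close>; note \<open>j (c - d i) = c j + d k\<close>.\<close>
definition perp_coords :: "octonion \<Rightarrow> complex^2" where
  "perp_coords x = (case snd x of (a, b, c, d) \<Rightarrow> \<chi> r. if r = 1 then Complex a b else Complex c (- d))"

definition perp_of_coords :: "complex^2 \<Rightarrow> octonion" where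
  "perp_of_coords u = (0, (Re (u $ 1), Im (u $ 1), Re (u $ 2), - Im (u $ 2)))"

lemma perp_coords_nth [simp]:
  "perp_coords (p, (a, b, c, d)) $ 1 = Complex a b" "perp_coords (p, (a, b, c, d)) $ 2 = Complex c (- d)"
  by (simp_all add: perp_coords_def)

lemma linear_perp_coords: "linear perp_coords"
proof (rule linearI)
  fix x y :: octonion and r :: real
  show "perp_coords (x + y) = perp_coords x + perp_coords y"
    by (rule octonion_cases [of x]; rule octonion_cases [of y])
      (simp add: vec_eq_iff forall_2 complex_eq_iff)
  show "perp_coords (r *\<^sub>R x) = r *\<^sub>R perp_coords x"
    by (rule octonion_cases [of x]) (simp add: vec_eq_iff forall_2 complex_eq_iff)
qed

lemma linear_perp_of_coords: "linear perp_of_coords"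
  by (intro linearI) (simp_all add: perp_of_coords_def)

lemma perp_coords_of_coords [simp]: "perp_coords (perp_of_coords u) = u"
  by (simp add: perp_of_coords_def vec_eq_iff forall_2)

lemma perp_of_coords_coords: "x \<in> Quat_perp \<Longrightarrow> perp_of_coords (perp_coords x) = x"
  by (rule octonion_cases [of x]) (simp add: perp_of_coords_def mem_Quat_perp)

lemma perp_of_coords_mem: "perp_of_coords u \<in> Quat_perp"
  by (simp add: perp_of_coords_def mem_Quat_perp)

lemma perp_coords_cmult:
  "x \<in> Quat_perp \<Longrightarrow> perp_coords (oct_of_complex z \<odot> x) = z *s perp_coords x"
  by (rule octonion_cases [of x])
    (simp add: mem_Quat_perp oct_of_complex_omult_perp vec_eq_iff forall_2 complex_eq_iff algebra_simps)

lemma perp_of_coords_cmult: "perp_of_coords (z *s u) = oct_of_complex z \<odot> perp_of_coords u"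
  by (simp add: perp_of_coords_def oct_of_complex_omult_perp algebra_simps)

text \<open>Linear in the first argument and conjugate linear in the second, matching
  \<sigma>.\<close>

definition hform :: "complex^2 \<Rightarrow> complex^2 \<Rightarrow> complex" where
  "hform u v = (\<Sum>r\<in>UNIV. u $ r * cnj (v $ r))"

lemma sigma_perp_coords:
  assumes "x \<in> Quat_perp" "y \<in> Quat_perp"
  shows "\<sigma> x y = hform (perp_coords x) (perp_coords y)"
proof -
  obtain a b c d a' b' c' d' where xy: "x = (0, a, b, c, d)" "y = (0, a', b', c', d')"
    using assms by (metis Quat_perp_cases prod.collapse)
  show ?thesis
    unfolding sigma_def oct_of_complex_i [symmetric]
    by (simp add: xy oct_of_complex_omult_perp hform_def sum_2 complex_eq_iff algebra_simps)
qed

section \<open>Unitary matrices and the isomorphism with U(2)\<close>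

lemma mem_U2: "A \<in> carrier U2 \<longleftrightarrow> (\<forall>s t. (\<Sum>r\<in>UNIV. cnj (A $ r $ s) * A $ r $ t) = (if s = t then 1 else 0))"
  by (simp add: U2_def vec_eq_iff matrix_matrix_mult_def transpose_def mat_def)

text \<open>Unitarity is stated as orthonormality of columns; once the sum over rows is innermost,
  this leaves only the terms s = t.\<close>

lemma hform_U2:
  assumes "A \<in> carrier U2"
  shows "hform (A *v u) (A *v v) = hform u v"
proof -
  have eq: "(\<Sum>r\<in>UNIV. A $ r $ s * cnj (A $ r $ t)) = (if s = t then 1 else 0)" for s t
    using assms [unfolded mem_U2, rule_format, of t s] by (auto simp: mult.commute)
  have "hform (A *v u) (A *v v) =
      (\<Sum>r\<in>UNIV. \<Sum>s\<in>UNIV. \<Sum>t\<in>UNIV. u $ s * cnj (v $ t) * (A $ r $ s * cnj (A $ r $ t)))"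
    by (simp add: hform_def matrix_vector_mult_def sum_product mult_ac)
  also have "\<dots> = (\<Sum>s\<in>UNIV. \<Sum>t\<in>UNIV. \<Sum>r\<in>UNIV. u $ s * cnj (v $ t) * (A $ r $ s * cnj (A $ r $ t)))"
    by (subst sum.swap, rule sum.cong [OF refl], subst sum.swap, rule refl)
  also have "\<dots> = (\<Sum>s\<in>UNIV. \<Sum>t\<in>UNIV. u $ s * cnj (v $ t) * (if s = t then 1 else 0))"
    by (simp add: eq flip: sum_distrib_left)
  also have "\<dots> = hform u v"
    by (simp add: hform_def if_distrib cong: if_cong)
  finally show ?thesis .
qed

lemma matrix_vector_mult_smult:
  fixes A :: "'a::comm_semiring_1^'n^'m"
  shows "A *v (c *s v) = c *s (A *v v)"
  by (simp add: vec_eq_iff matrix_vector_mult_def sum_distrib_left mult_ac)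

definition perp_matrix :: "(octonion \<Rightarrow> octonion) \<Rightarrow> complex^2^2" where
  "perp_matrix g = (\<chi> r s. perp_coords (g (perp_of_coords (axis s 1))) $ r)"

definition perp_of_matrix :: "complex^2^2 \<Rightarrow> octonion \<Rightarrow> octonion" where
  "perp_of_matrix A = (\<lambda>x\<in>Quat_perp. perp_of_coords (A *v perp_coords x))"

text \<open>Expand x in the complex basis of \<open>Quat_perp\<close>: additivity and complex
  linearity determine g x from the values on the two basis vectors, which are the columns of the
  matrix.\<close>

lemma perp_matrix_mult_vec:
  assumes "g \<in> carrier U_sigma" "x \<in> Quat_perp"
  shows "perp_matrix g *v perp_coords x = perp_coords (g x)"
proof -
  note g = U_sigma_D [OF assms(1)]
  let ?u = "perp_coords x"
  let ?e = "\<lambda>s. perp_of_coords (axis s 1)"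
  have "?u = ?u $ 1 *s axis 1 1 + ?u $ 2 *s axis 2 1"
    by (simp add: vec_eq_iff forall_2 axis_def)
  then have "perp_of_coords ?u = perp_of_coords (?u $ 1 *s axis 1 1 + ?u $ 2 *s axis 2 1)"
    by (rule arg_cong)
  then have "x = oct_of_complex (?u $ 1) \<odot> ?e 1 + oct_of_complex (?u $ 2) \<odot> ?e 2"
    by (simp only: perp_of_coords_coords [OF assms(2)] linear_add [OF linear_perp_of_coords]
        perp_of_coords_cmult)
  moreover have "oct_of_complex z \<odot> ?e s \<in> Quat_perp" for z s
    by (metis perp_of_coords_cmult perp_of_coords_mem)
  ultimately have "g x = oct_of_complex (?u $ 1) \<odot> g (?e 1) + oct_of_complex (?u $ 2) \<odot> g (?e 2)"
    using g(4,5) perp_of_coords_mem by metis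
  then have "perp_coords (g x) = ?u $ 1 *s perp_coords (g (?e 1)) + ?u $ 2 *s perp_coords (g (?e 2))"
    using g(3) [OF perp_of_coords_mem]
    by (simp add: linear_add [OF linear_perp_coords] perp_coords_cmult)
  then show ?thesis
    by (simp add: vec_eq_iff matrix_vector_mult_def sum_2 perp_matrix_def mult.commute)
qed

lemma perp_matrix_U2:
  assumes "g \<in> carrier U_sigma"
  shows "perp_matrix g \<in> carrier U2" "perp_of_matrix (perp_matrix g) = g"
proof -
  note g = U_sigma_D [OF assms(1)]
  let ?e = "\<lambda>s. perp_of_coords (axis s 1)"
  have "(\<Sum>r\<in>UNIV. cnj (perp_matrix g $ r $ s) * perp_matrix g $ r $ t) = (if s = t then 1 else 0)" for s t
  proof -
    have "(\<Sum>r\<in>UNIV. cnj (perp_matrix g $ r $ s) * perp_matrix g $ r $ t) =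
        hform (perp_coords (g (?e t))) (perp_coords (g (?e s)))"
      by (simp add: hform_def perp_matrix_def mult.commute)
    also have "\<dots> = hform (axis t 1) (axis s 1)"
      using g(6) [OF perp_of_coords_mem perp_of_coords_mem, of "axis t 1" "axis s 1"]
        g(3) [OF perp_of_coords_mem] by (simp add: sigma_perp_coords perp_of_coords_mem)
    finally show ?thesis
      using exhaust_2 [of s] exhaust_2 [of t] by (auto simp: hform_def axis_def sum_2)
  qed
  then show "perp_matrix g \<in> carrier U2"
    by (simp add: mem_U2)
  show "perp_of_matrix (perp_matrix g) = g"
    by (intro extensionalityI [OF _ g(2)])
      (simp_all add: perp_of_matrix_def perp_matrix_mult_vec [OF assms] perp_of_coords_coords g(3))
qed

lemma perp_of_matrix_U_sigma:
  assumes "A \<in> carrier U2"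
  shows "perp_of_matrix A \<in> carrier U_sigma" "perp_matrix (perp_of_matrix A) = A"
proof -
  define B where "B = map_matrix cnj (transpose A)"
  have "B ** A = mat 1"
    using assms by (simp add: U2_def B_def)
  \<comment> \<open>A left inverse of a square matrix is two-sided, so B provides the inverse map
    that bijectivity requires.\<close>
  then have BA: "B ** A = mat 1" "A ** B = mat 1"
    using matrix_left_right_inverse by blast+
  have "bij_betw (perp_of_matrix A) Quat_perp Quat_perp"
    by (rule bij_betw_byWitness [where f' = "perp_of_matrix B"])
      (auto simp: perp_of_matrix_def perp_of_coords_mem matrix_vector_mul_assoc BA perp_of_coords_coords)
  moreover have "oct_of_complex z \<odot> x \<in> Quat_perp" if "x \<in> Quat_perp" for z x
    using that by (auto elim!: Quat_perp_cases simp: oct_of_complex_omult_perp zero_Pair_Quat_perp)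
  ultimately show "perp_of_matrix A \<in> carrier U_sigma"
    unfolding mem_U_sigma
    using subspace_add [OF subspace_orthogonal_comp [of Quat]]
    by (simp add: Bij_def perp_of_matrix_def linear_add [OF linear_perp_coords]
        linear_add [OF linear_perp_of_coords] matrix_vector_right_distrib perp_coords_cmult
        matrix_vector_mult_smult perp_of_coords_cmult perp_of_coords_mem sigma_perp_coords hform_U2 [OF assms]
        del: split_paired_All)
  have "(A *v axis s 1) $ r = A $ r $ s" for r s
    using exhaust_2 [of s] by (auto simp: matrix_vector_mult_def axis_def sum_2)
  then show "perp_matrix (perp_of_matrix A) = A"
    by (simp add: perp_matrix_def perp_of_matrix_def perp_of_coords_mem vec_eq_iff)
qed

lemma perp_matrix_homeomorphic:
  "homeomorphic_map (top_of_set (carrier U_sigma)) (top_of_set (carrier U2)) perp_matrix"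
  and perp_matrix_bij: "bij_betw perp_matrix (carrier U_sigma) (carrier U2)"
proof -
  have 1: "continuous_on (carrier U_sigma) perp_matrix"
    unfolding perp_matrix_def
    by (intro continuous_on_vec_lambda continuous_on_component
        continuous_on_linear_compose [OF linear_perp_coords] continuous_on_eval)
  have "linear (\<lambda>A. A *v v)" for v :: "complex^2"
    by (intro linearI)
      (simp_all add: vec_eq_iff matrix_vector_mult_def distrib_right sum.distrib scaleR_right.sum)
  then have cont: "continuous_on (carrier U2) (\<lambda>A. perp_of_coords (A *v v))" for v
    by (intro continuous_on_linear_compose [OF linear_perp_of_coords]
        continuous_on_linear_compose [OF _ continuous_on_id])
  have 2: "continuous_on (carrier U2) perp_of_matrix"
  proof (intro continuous_on_coordinatewise_then_product)
    show "continuous_on (carrier U2) (\<lambda>A. perp_of_matrix A x)" for x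
      unfolding perp_of_matrix_def by (cases "x \<in> Quat_perp") (simp_all add: cont)
  qed
  show "homeomorphic_map (top_of_set (carrier U_sigma)) (top_of_set (carrier U2)) perp_matrix"
    "bij_betw perp_matrix (carrier U_sigma) (carrier U2)"
    using homeomorphic_map_top_of_setI [OF 1 2]
    by (simp_all add: perp_matrix_U2 perp_of_matrix_U_sigma)
qed

lemma perp_matrix_iso: "perp_matrix \<in> iso U_sigma U2"
proof -
  have "perp_matrix (g \<otimes>\<^bsub>U_sigma\<^esub> h) = perp_matrix g ** perp_matrix h"
    if "g \<in> carrier U_sigma" "h \<in> carrier U_sigma" for g h
  proof -
    have "perp_matrix (g \<otimes>\<^bsub>U_sigma\<^esub> h) $ r $ s = (perp_matrix g ** perp_matrix h) $ r $ s" for r s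
    proof -
      let ?y = "h (perp_of_coords (axis s 1))"
      have "perp_matrix (g \<otimes>\<^bsub>U_sigma\<^esub> h) $ r $ s = perp_coords (g ?y) $ r"
        by (simp add: perp_matrix_def mult_U_sigma that compose_def perp_of_coords_mem)
      also have "\<dots> = (perp_matrix g *v perp_coords ?y) $ r"
        using perp_matrix_mult_vec [OF that(1) U_sigma_D(3) [OF that(2) perp_of_coords_mem]] by simp
      also have "\<dots> = (perp_matrix g ** perp_matrix h) $ r $ s"
        by (simp add: matrix_vector_mult_def matrix_matrix_mult_def perp_matrix_def [of h])
      finally show ?thesis .
    qed
    then show ?thesis
      by (simp add: vec_eq_iff)
  qed
  then show ?thesis
    using perp_matrix_bij perp_matrix_U2 by (auto simp: iso_def hom_def U2_def)
qed

section \<open>The topology of \<open>M2\<close>\<close>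

text \<open>Pythagoras. It identifies the nearest-point map of a subspace with its orthogonal
  projection.\<close>

lemma closest_point_subspace:
  fixes W :: "'a::euclidean_space set"
  assumes "subspace W" "p \<in> W" "\<And>z. z \<in> W \<Longrightarrow> orthogonal (x - p) z"
  shows "closest_point W x = p"
proof (rule closest_point_unique [symmetric])
  show "\<forall>z\<in>W. dist x p \<le> dist x z"
  proof
    fix z assume "z \<in> W"
    then have "orthogonal (x - p) (p - z)"
      using assms by (simp add: subspace_diff)
    then have "(norm (x - z))\<^sup>2 = (norm (x - p))\<^sup>2 + (norm (p - z))\<^sup>2"
      using norm_add_Pythagorean by fastforce
    then show "dist x p \<le> dist x z"
      by (simp add: dist_norm) (metis le_add_same_cancel1 norm_ge_zero power2_le_imp_le zero_le_power2)
  qed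
qed (use assms in \<open>simp_all add: subspace_imp_convex closed_subspace\<close>)

text \<open>A subspace is closed, hence the fixed-point set of its nearest-point map. This makes the
  map defining \<open>M2_top\<close> injective, which is what the Hausdorff property rests
  on.\<close>

lemma closest_point_subspace_inject:
  fixes V W :: "'a::euclidean_space set"
  assumes "subspace V" "subspace W" "closest_point V = closest_point W"
  shows "V = W"
proof -
  have "x \<in> V \<longleftrightarrow> closest_point V x = x" "x \<in> W \<longleftrightarrow> closest_point W x = x" for x
    using assms(1,2) closest_point_refl closed_subspace subspace_0 by (metis empty_iff)+
  then show ?thesis
    using assms(3) by auto
qed

lemma stiefel_orthonormal:
  assumes "(w, X) \<in> stiefel"
  shows "oct_1 \<bullet> w = 0" "oct_1 \<bullet> X = 0" "oct_1 \<bullet> (w \<odot> X) = 0" "w \<bullet> X = 0" "w \<bullet> (w \<odot> X) = 0"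
    "X \<bullet> (w \<odot> X) = 0" "w \<bullet> w = 1" "X \<bullet> X = 1" "(w \<odot> X) \<bullet> (w \<odot> X) = 1"
  using assms stiefel_omult_table [OF assms] by (simp_all add: mem_stiefel mem_Im_Oct inner_commute)

text \<open>For fixed x the right-hand side is polynomial in w and X, so the projection depends
  continuously on the frame.\<close>

lemma closest_point_quat_span:
  assumes "(w, X) \<in> stiefel"
  shows "closest_point (span {oct_1, w, X, w \<odot> X}) x =
    (x \<bullet> oct_1) *\<^sub>R oct_1 + (x \<bullet> w) *\<^sub>R w + (x \<bullet> X) *\<^sub>R X + (x \<bullet> (w \<odot> X)) *\<^sub>R (w \<odot> X)"
    (is "closest_point ?S x = ?p")
proof (rule closest_point_subspace)
  show "?p \<in> ?S"
    by (intro span_add span_scale) (simp_all add: span_base)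
  have e: "\<forall>e\<in>{oct_1, w, X, w \<odot> X}. orthogonal (x - ?p) e"
    using stiefel_orthonormal [OF assms]
    by (simp add: orthogonal_def inner_diff_left inner_add_left) (simp add: inner_commute)
  show "orthogonal (x - ?p) z" if "z \<in> ?S" for z
    using orthogonal_to_span [OF that] e by blast
qed (rule subspace_span)

lemma Hausdorff_space_M2_top: "Hausdorff_space M2_top"
proof -
  have "Hausdorff_space (euclidean :: (octonion \<Rightarrow> octonion) topology)"
    by (simp add: Hausdorff_space_product_topology flip: euclidean_product_topology)
  then have "Hausdorff_space (euclidean :: (octonion \<times> (octonion \<Rightarrow> octonion)) topology)"
    by (simp add: Hausdorff_space_prod_topology flip: prod_topology_euclidean)
  moreover have "continuous_map M2_top euclidean (id \<circ> (\<lambda>(w, W). (w, closest_point W)))"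
    unfolding M2_top_def by (rule continuous_map_pullback) simp
  then have "continuous_map M2_top euclidean (\<lambda>(w, W). (w, closest_point W))"
    by simp
  moreover have "inj_on (\<lambda>(w, W). (w, closest_point W)) M2"
    using closest_point_subspace_inject by (auto simp only: inj_on_def M2_def M1_def prod.inject)
  ultimately show ?thesis
    by (metis Hausdorff_space_injective_preimage topspace_M2_top)
qed

text \<open>The continuity shared by both homeomorphisms: the orbit map and the map on oriented
  frames are each composed of this map and a continuous map into \<open>stiefel\<close>.\<close>

lemma continuous_map_quat_span:
  "continuous_map (top_of_set stiefel) M2_top (\<lambda>(w, X). (w, span {oct_1, w, X, w \<odot> X}))"
  unfolding M2_top_def
proof (rule continuous_map_pullback')
  have "continuous_on stiefel (\<lambda>b. (fst b, \<lambda>x. (x \<bullet> oct_1) *\<^sub>R oct_1 + (x \<bullet> fst b) *\<^sub>R fst b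
      + (x \<bullet> snd b) *\<^sub>R snd b + (x \<bullet> (fst b \<odot> snd b)) *\<^sub>R (fst b \<odot> snd b)))"
    by (intro continuous_on_Pair continuous_on_coordinatewise_then_product continuous_intros
        omult.continuous_on)
  then have "continuous_on stiefel ((\<lambda>(w, W). (w, closest_point W)) \<circ> (\<lambda>(w, X). (w, span {oct_1, w, X, w \<odot> X})))"
  proof (rule continuous_on_eq)
    fix b :: "octonion \<times> octonion"
    assume "b \<in> stiefel"
    moreover obtain w X where "b = (w, X)"
      by (metis prod.exhaust)
    ultimately show "(fst b, \<lambda>x. (x \<bullet> oct_1) *\<^sub>R oct_1 + (x \<bullet> fst b) *\<^sub>R fst b + (x \<bullet> snd b) *\<^sub>R snd b
        + (x \<bullet> (fst b \<odot> snd b)) *\<^sub>R (fst b \<odot> snd b)) =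
        ((\<lambda>(w, W). (w, closest_point W)) \<circ> (\<lambda>(w, X). (w, span {oct_1, w, X, w \<odot> X}))) b"
      by (simp add: closest_point_quat_span fun_eq_iff del: split_paired_All)
  qed
  then show "continuous_map (top_of_set stiefel) euclidean
      ((\<lambda>(w, W). (w, closest_point W)) \<circ> (\<lambda>(w, X). (w, span {oct_1, w, X, w \<odot> X})))"
    by simp
  show "topspace (top_of_set stiefel) \<subseteq> (\<lambda>(w, X). (w, span {oct_1, w, X, w \<odot> X})) -` M2"
    using quat_span_M2 by (auto simp only: topspace_euclidean_subtopology)
qed

lemma compact_quotient_homeomorphic_map:
  assumes "compact_space X" "Hausdorff_space Y" "\<pi> ` topspace X = S"
    and cont: "continuous_map X Y (g \<circ> \<pi>)" and "inj_on g S" "g ` S = topspace Y"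
  shows "homeomorphic_map (quotient_topology X \<pi> S) Y g"
proof (rule continuous_imp_homeomorphic_map)
  have top: "topspace (quotient_topology X \<pi> S) = S"
    using assms(3) by (simp add: topspace_quotient_topology)
  have "continuous_map X (quotient_topology X \<pi> S) \<pi>"
    using assms(3) by (auto simp: continuous_map_def top openin_quotient_topology)
  then have "compactin (quotient_topology X \<pi> S) (\<pi> ` topspace X)"
    using assms(1) image_compactin unfolding compact_space_def by blast
  then show "compact_space (quotient_topology X \<pi> S)"
    by (simp add: compact_space_def top assms(3))
  have "openin (quotient_topology X \<pi> S) {y \<in> S. g y \<in> U}" if "openin Y U" for U
  proof -
    have "{x \<in> topspace X. \<pi> x \<in> {y \<in> S. g y \<in> U}} = {x \<in> topspace X. (g \<circ> \<pi>) x \<in> U}"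
      using assms(3) by auto
    then show ?thesis
      using openin_continuous_map_preimage [OF cont that] by (auto simp: openin_quotient_topology)
  qed
  then show "continuous_map (quotient_topology X \<pi> S) Y g"
    using assms(6) by (auto simp: continuous_map_def top)
  show "g ` topspace (quotient_topology X \<pi> S) = topspace Y" "inj_on g (topspace (quotient_topology X \<pi> S))"
    using assms by (simp_all add: top)
qed (use assms in auto)

section \<open>\<open>M2\<close> as a homogeneous space\<close>

text \<open>Norm preservation confines f x to the ball of radius |x|, so \<open>G2\<close> lies in a
  product of compact balls. Within it the conditions are equations between evaluations, hence
  closed; the equation f(1) = 1 stands in for bijectivity, which is not visibly a closed
  condition.\<close>

lemma compact_G2: "compact (carrier G2)"
proof -
  have eval: "continuous_on UNIV (\<lambda>f :: octonion \<Rightarrow> octonion. f x)" for x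
    by (rule continuous_on_eval)
  let ?B = "PiE UNIV (\<lambda>x :: octonion. cball 0 (norm x) :: octonion set)"
  let ?C = "{f. (\<forall>x y. f (x + y) = f x + f y) \<and> (\<forall>r x. f (r *\<^sub>R x) = r *\<^sub>R f x) \<and>
      (\<forall>x y. f (x \<odot> y) = f x \<odot> f y) \<and> f oct_1 = oct_1}"
  have "compactin (product_topology (\<lambda>_. euclidean) UNIV) ?B"
    by (simp add: compactin_PiE)
  then have "compact ?B"
    by (simp add: euclidean_product_topology)
  moreover have "closed ?C"
    by (intro closed_Collect_conj closed_Collect_all closed_Collect_eq eval continuous_intros omult.continuous_on)
  ultimately have cpt: "compact (?B \<inter> ?C)"
    by (rule compact_Int_closed)
  have C: "f \<in> ?C \<longleftrightarrow> octonion_aut f" for f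
    unfolding octonion_aut_iff linear_iff by blast
  have B: "f \<in> ?B" if "octonion_aut f" for f
    using octonion_aut_orthogonal [OF that] by (simp add: orthogonal_transformation_norm PiE_iff)
  have "?B \<inter> ?C = {f. octonion_aut f}"
    using B C by blast
  with cpt show ?thesis
    by (simp only: G2_simps)
qed

lemma M2_act_base:
  assumes "octonion_aut f"
  shows "(f oct_i, f oct_j) \<in> stiefel"
    and "M2_act f (oct_i, Quat) = (f oct_i, span {oct_1, f oct_i, f oct_j, f oct_i \<odot> f oct_j})"
proof -
  show "(f oct_i, f oct_j) \<in> stiefel"
    using stiefel_ij by (simp add: mem_stiefel octonion_aut_Im [OF assms] octonion_aut_inner [OF assms])
  have "f ` Quat = span (f ` {oct_1, oct_i, oct_j, oct_i \<odot> oct_j})"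
    unfolding Quat_eq_quat_span by (rule linear_span_image [OF octonion_aut_linear [OF assms], symmetric])
  then show "M2_act f (oct_i, Quat) = (f oct_i, span {oct_1, f oct_i, f oct_j, f oct_i \<odot> f oct_j})"
    using base_M2 by (simp add: M2_act_def octonion_aut_one [OF assms] octonion_aut_omult [OF assms])
qed

lemma continuous_map_orbit: "continuous_map (top_of_set (carrier G2)) M2_top (\<lambda>f. M2_act f (oct_i, Quat))"
proof -
  have "continuous_on (carrier G2) (\<lambda>f. (f oct_i, f oct_j))"
    by (intro continuous_on_Pair continuous_on_eval)
  then have "continuous_map (top_of_set (carrier G2)) (top_of_set stiefel) (\<lambda>f. (f oct_i, f oct_j))"
    by (simp add: M2_act_base)
  from continuous_map_compose [OF this continuous_map_quat_span] show ?thesis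
    by (rule continuous_map_eq) (simp add: M2_act_base)
qed

text \<open>The orbit map factored through cosets. The choice of representative is harmless, as two
  of them differ by an element of \<open>H2\<close>, which fixes (i, H).\<close>

definition coset_orbit :: "(octonion \<Rightarrow> octonion) set \<Rightarrow> octonion \<times> octonion set" where
  "coset_orbit C = M2_act (SOME f. f \<in> C) (oct_i, Quat)"

lemma subgroup_H2: "subgroup H2 G2"
  using group_action.stabilizer_subgroup [OF group_action_M2 base_M2] by (simp only: stabilizer_M2)

lemma coset_orbit_eq:
  assumes "f \<in> carrier G2"
  shows "coset_orbit (f <#\<^bsub>G2\<^esub> H2) = M2_act f (oct_i, Quat)"
proof -
  have "(SOME g. g \<in> f <#\<^bsub>G2\<^esub> H2) \<in> f <#\<^bsub>G2\<^esub> H2"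
    using group.lcos_self [OF group_G2 assms subgroup_H2] by (rule someI [where P = "\<lambda>g. g \<in> f <#\<^bsub>G2\<^esub> H2"])
  then obtain h where h: "h \<in> H2" "(SOME g. g \<in> f <#\<^bsub>G2\<^esub> H2) = f \<otimes>\<^bsub>G2\<^esub> h"
    unfolding l_coset_def by blast
  then have "h \<in> carrier G2" "M2_act h (oct_i, Quat) = (oct_i, Quat)"
    unfolding stabilizer_M2 [symmetric] stabilizer_def by auto
  then show ?thesis
    using group_action.composition_rule [OF group_action_M2 base_M2 assms, of h]
    unfolding coset_orbit_def h(2) by (simp del: G2_simps)
qed

lemma coset_orbit_inj: "inj_on coset_orbit (lcosets\<^bsub>G2\<^esub> H2)"
proof (rule inj_onI)
  fix C D assume "C \<in> lcosets\<^bsub>G2\<^esub> H2" "D \<in> lcosets\<^bsub>G2\<^esub> H2" and eq: "coset_orbit C = coset_orbit D"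
  then obtain f g where fg: "f \<in> carrier G2" "C = f <#\<^bsub>G2\<^esub> H2" "g \<in> carrier G2" "D = g <#\<^bsub>G2\<^esub> H2"
    by (auto simp only: LCOSETS_def)
  interpret group_action G2 M2 M2_act
    by (rule group_action_M2)
  interpret G2: group G2
    by (rule group_G2)
  let ?h = "inv\<^bsub>G2\<^esub> f \<otimes>\<^bsub>G2\<^esub> g"
  have h: "?h \<in> carrier G2"
    using fg by (simp del: G2_simps)
  have "M2_act g (oct_i, Quat) = M2_act f (oct_i, Quat)"
    using eq fg coset_orbit_eq by metis
  then have "M2_act ?h (oct_i, Quat) = (oct_i, Quat)"
    using composition_rule [OF base_M2 G2.inv_closed [OF fg(1)] fg(3)] orbit_sym_aux [OF fg(1) base_M2 refl]
    by (simp del: G2_simps)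
  then have "?h \<in> H2"
    using h unfolding stabilizer_M2 [symmetric] stabilizer_def by blast
  moreover have "g = f \<otimes>\<^bsub>G2\<^esub> ?h"
    using fg by (simp add: G2.m_assoc [symmetric] del: G2_simps)
  ultimately have "g \<in> f <#\<^bsub>G2\<^esub> H2"
    unfolding l_coset_def by blast
  then show "C = D"
    using G2.l_repr_independence [OF _ fg(1) subgroup_H2] fg by simp
qed

lemma coset_orbit_homeomorphic: "homeomorphic_map G2_mod_H2_top M2_top coset_orbit"
  unfolding G2_mod_H2_top_def
proof (rule compact_quotient_homeomorphic_map)
  show "compact_space (top_of_set (carrier G2))"
    using compact_G2 by (intro compact_space_subtopology) simp
  show "(\<lambda>f. f <#\<^bsub>G2\<^esub> H2) ` topspace (top_of_set (carrier G2)) = lcosets\<^bsub>G2\<^esub> H2"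
    by (auto simp: LCOSETS_def)
  show "continuous_map (top_of_set (carrier G2)) M2_top (coset_orbit \<circ> (\<lambda>f. f <#\<^bsub>G2\<^esub> H2))"
    using continuous_map_orbit by (rule continuous_map_eq) (simp add: coset_orbit_eq)
  have "coset_orbit ` (lcosets\<^bsub>G2\<^esub> H2) = (\<lambda>f. M2_act f (oct_i, Quat)) ` carrier G2"
    using coset_orbit_eq by (force simp only: LCOSETS_def)
  also have "\<dots> = M2"
  proof
    show "(\<lambda>f. M2_act f (oct_i, Quat)) ` carrier G2 \<subseteq> M2"
      using group_action.element_image [OF group_action_M2 _ base_M2] by blast
    show "M2 \<subseteq> (\<lambda>f. M2_act f (oct_i, Quat)) ` carrier G2"
      using M2_reachable by (intro subsetI) (blast intro: image_eqI sym)
  qed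
  finally show "coset_orbit ` (lcosets\<^bsub>G2\<^esub> H2) = topspace M2_top"
    by (simp add: topspace_M2_top)
qed (simp_all add: Hausdorff_space_M2_top coset_orbit_inj)

lemma coset_orbit_equivariant:
  assumes "f \<in> carrier G2" "C \<in> lcosets\<^bsub>G2\<^esub> H2"
  shows "coset_orbit (f <#\<^bsub>G2\<^esub> C) = M2_act f (coset_orbit C)"
proof -
  obtain g where g: "g \<in> carrier G2" "C = g <#\<^bsub>G2\<^esub> H2"
    using assms(2) by (auto simp only: LCOSETS_def)
  have "f <#\<^bsub>G2\<^esub> C = (f \<otimes>\<^bsub>G2\<^esub> g) <#\<^bsub>G2\<^esub> H2"
    unfolding g(2) by (rule group.lcos_m_assoc [OF group_G2 subgroup.subset [OF subgroup_H2] assms(1) g(1)])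
  moreover have "f \<otimes>\<^bsub>G2\<^esub> g \<in> carrier G2"
    using monoid.m_closed [OF group.is_monoid [OF group_G2] assms(1) g(1)] .
  ultimately show ?thesis
    using group_action.composition_rule [OF group_action_M2 base_M2 assms(1) g(1)]
    by (simp add: coset_orbit_eq g del: G2_simps)
qed

section \<open>Oriented planes\<close>

lemma same_orientationI:
  assumes "(u, v) \<in> plane_bases P" "(u', v') \<in> plane_bases P"
    and "u' = a *\<^sub>R u + b *\<^sub>R v" "v' = c *\<^sub>R u + d *\<^sub>R v" "a * d - b * c > 0"
  shows "((u, v), (u', v')) \<in> same_orientation P"
  using assms unfolding same_orientation_def by blast

lemma same_orientationE:
  assumes "((u, v), (u', v')) \<in> same_orientation P"
  obtains a b c d where "(u, v) \<in> plane_bases P" "(u', v') \<in> plane_bases P"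
    "u' = a *\<^sub>R u + b *\<^sub>R v" "v' = c *\<^sub>R u + d *\<^sub>R v" "a * d - b * c > 0"
  using assms unfolding same_orientation_def by blast

lemma equiv_same_orientation: "equiv (plane_bases P) (same_orientation P)"
proof (rule equivI)
  show "same_orientation P \<subseteq> plane_bases P \<times> plane_bases P"
    unfolding same_orientation_def by blast
  show "refl_on (plane_bases P) (same_orientation P)"
  proof (rule refl_onI)
    fix p assume "p \<in> plane_bases P"
    then show "(p, p) \<in> same_orientation P"
      using same_orientationI [where a = 1 and b = 0 and c = 0 and d = 1 and u = "fst p" and v = "snd p"
          and u' = "fst p" and v' = "snd p"] by simp
  qed
  show "sym (same_orientation P)"
  proof (rule symI)
    fix p q assume pq: "(p, q) \<in> same_orientation P"
    obtain u v u' v' where eqs: "p = (u, v)" "q = (u', v')"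
      by (metis prod.exhaust)
    obtain a b c d where B: "(u, v) \<in> plane_bases P" "(u', v') \<in> plane_bases P"
      and ab: "u' = a *\<^sub>R u + b *\<^sub>R v" "v' = c *\<^sub>R u + d *\<^sub>R v" and pos: "a * d - b * c > 0"
      using pq unfolding eqs by (rule same_orientationE)
    \<comment> \<open>Cramer's rule: the inverse base change is the adjugate matrix over D, with
      determinant 1/D > 0.\<close>
    define D where "D = a * d - b * c"
    have "d *\<^sub>R u' - b *\<^sub>R v' = D *\<^sub>R u" "a *\<^sub>R v' - c *\<^sub>R u' = D *\<^sub>R v"
      by (simp_all add: ab D_def algebra_simps)
    then have "u = (1 / D) *\<^sub>R (d *\<^sub>R u' - b *\<^sub>R v')" "v = (1 / D) *\<^sub>R (a *\<^sub>R v' - c *\<^sub>R u')"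
      using pos by (simp_all add: D_def)
    then have "u = (d / D) *\<^sub>R u' + (- b / D) *\<^sub>R v'" "v = (- c / D) *\<^sub>R u' + (a / D) *\<^sub>R v'"
      by (simp_all add: algebra_simps)
    moreover have "(d / D) * (a / D) - (- b / D) * (- c / D) = D / (D * D)"
      by (simp add: D_def diff_divide_distrib algebra_simps)
    then have "(d / D) * (a / D) - (- b / D) * (- c / D) > 0"
      using pos by (simp add: D_def)
    ultimately show "(q, p) \<in> same_orientation P"
      unfolding eqs using B by (intro same_orientationI)
  qed
  show "trans (same_orientation P)"
  proof (rule transI)
    fix p q r assume pqr: "(p, q) \<in> same_orientation P" "(q, r) \<in> same_orientation P"
    obtain u v u' v' u'' v'' where eqs: "p = (u, v)" "q = (u', v')" "r = (u'', v'')"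
      by (metis prod.exhaust)
    obtain a b c d where 1: "(u, v) \<in> plane_bases P"
      and ab: "u' = a *\<^sub>R u + b *\<^sub>R v" "v' = c *\<^sub>R u + d *\<^sub>R v" and pos: "a * d - b * c > 0"
      using pqr(1) unfolding eqs by (rule same_orientationE)
    obtain a' b' c' d' where 2: "(u'', v'') \<in> plane_bases P"
      and ab': "u'' = a' *\<^sub>R u' + b' *\<^sub>R v'" "v'' = c' *\<^sub>R u' + d' *\<^sub>R v'" and pos': "a' * d' - b' * c' > 0"
      using pqr(2) unfolding eqs by (rule same_orientationE)
    have "u'' = (a' * a + b' * c) *\<^sub>R u + (a' * b + b' * d) *\<^sub>R v"
      "v'' = (c' * a + d' * c) *\<^sub>R u + (c' * b + d' * d) *\<^sub>R v"
      by (simp_all add: ab ab' algebra_simps)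
    \<comment> \<open>Multiplicativity of the 2 x 2 determinant.\<close>
    moreover have "(a' * a + b' * c) * (c' * b + d' * d) - (a' * b + b' * d) * (c' * a + d' * c) =
        (a' * d' - b' * c') * (a * d - b * c)"
      by (simp add: algebra_simps)
    then have "(a' * a + b' * c) * (c' * b + d' * d) - (a' * b + b' * d) * (c' * a + d' * c) > 0"
      using pos pos' by simp
    ultimately show "(p, r) \<in> same_orientation P"
      unfolding eqs using 1 2 by (intro same_orientationI)
  qed
qed

abbreviation oriented_span :: "octonion \<times> octonion \<Rightarrow> oriented_plane" where
  "oriented_span \<equiv> \<lambda>(u, v). oriented_by (span {u, v}) (u, v)"

lemma oriented_by_eq_iff:
  assumes "b \<in> plane_bases P" "b' \<in> plane_bases P"
  shows "oriented_by P b = oriented_by P b' \<longleftrightarrow> (b, b') \<in> same_orientation P"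
  using assms by (simp add: oriented_by_def eq_equiv_class_iff [OF equiv_same_orientation])

lemma stiefel_plane_bases:
  assumes "(u, v) \<in> stiefel" "u \<in> P" "v \<in> P" "subspace P" "dim P = 2"
  shows "(u, v) \<in> plane_bases P"
proof -
  have ne: "u \<noteq> v" "u \<noteq> 0" "v \<noteq> 0" and orth: "u \<bullet> v = 0"
    using assms(1) by (auto simp only: mem_stiefel inner_zero_left zero_neq_one)
  then have indep: "independent {u, v}"
    by (intro pairwise_orthogonal_independent) (simp_all add: pairwise_insert orthogonal_def inner_commute)
  have "dim (span {u, v}) = 2"
    using dim_eq_card_independent [OF indep] ne by simp
  then have "span {u, v} = P"
    using assms by (intro subspace_dim_equal) (simp_all add: span_minimal subspace_span)
  then show ?thesis
    using ne indep by (simp add: plane_bases_def)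
qed

lemma stiefel_span_plane_bases:
  assumes "(u, v) \<in> stiefel"
  shows "(u, v) \<in> plane_bases (span {u, v})"
proof -
  have "dim (span {u, v}) = 2"
    using stiefel_oriented_by [OF assms] by (simp add: Gr_def oriented_by_def)
  then show ?thesis
    using assms by (intro stiefel_plane_bases) (simp_all add: span_base)
qed

text \<open>Gram-Schmidt applied to a representing basis: the base change is triangular with
  positive diagonal, so the orientation is kept.\<close>

lemma Gr_oriented_onb:
  assumes "\<alpha> \<in> Gr"
  obtains u v where "(u, v) \<in> stiefel" "\<alpha> = oriented_span (u, v)"
proof -
  obtain P c where \<alpha>: "\<alpha> = (P, c)"
    by (cases \<alpha> rule: prod.exhaust)
  with assms have P: "subspace P" "P \<subseteq> Im_Oct" "dim P = 2" "c \<in> plane_bases P // same_orientation P"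
    by (auto simp: Gr_def)
  from P(4) obtain p q where pq: "(p, q) \<in> plane_bases P" "c = same_orientation P `` {(p, q)}"
    by (metis quotientE prod.exhaust)
  then have indep: "independent {p, q}" "p \<noteq> q" "span {p, q} = P"
    by (auto simp: plane_bases_def)
  then have pqP: "p \<in> P" "q \<in> P"
    by (metis insertI1 insertI2 span_base)+
  have p0: "p \<noteq> 0"
    using indep(1) dependent_zero by blast
  define u where "u = (1 / norm p) *\<^sub>R p"
  define x where "x = q - (q \<bullet> u) *\<^sub>R u"
  define v where "v = (1 / norm x) *\<^sub>R x"
  have uu: "u \<bullet> u = 1"
    using p0 by (simp add: u_def dot_square_norm power2_eq_square)
  have x0: "x \<noteq> 0"
  proof
    assume "x = 0"
    then have "q = (q \<bullet> u) *\<^sub>R u"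
      by (simp add: x_def)
    then have "q \<in> span {p}"
      unfolding u_def by (metis span_base span_scale insertI1)
    then show False
      using indep(1,2) independent_insert [of q "{p}"] by (simp add: insert_commute)
  qed
  then have "v \<bullet> v = 1"
    by (simp add: v_def dot_square_norm power2_eq_square)
  moreover have "u \<bullet> v = 0"
    by (simp add: v_def x_def inner_diff_right inner_commute uu)
  moreover have uvP: "u \<in> P" "v \<in> P"
    using pqP P(1) by (simp_all add: u_def v_def x_def subspace_scale subspace_diff)
  ultimately have uv: "(u, v) \<in> stiefel"
    using P(2) uu unfolding mem_stiefel by blast
  have uvB: "(u, v) \<in> plane_bases P"
    using stiefel_plane_bases [OF uv uvP P(1,3)] .
  have "((p, q), (u, v)) \<in> same_orientation P"
  proof (rule same_orientationI [OF pq(1) uvB])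
    show "u = (1 / norm p) *\<^sub>R p + 0 *\<^sub>R q"
      by (simp add: u_def)
    show "v = (- (q \<bullet> u) / (norm x * norm p)) *\<^sub>R p + (1 / norm x) *\<^sub>R q"
      by (simp add: v_def x_def u_def algebra_simps)
    show "0 < (1 / norm p) * (1 / norm x) - 0 * (- (q \<bullet> u) / (norm x * norm p))"
      using p0 x0 by simp
  qed
  then have "oriented_by P (p, q) = oriented_by P (u, v)"
    using pq(1) uvB by (simp add: oriented_by_eq_iff)
  moreover have "span {u, v} = P"
    using uvB by (simp add: plane_bases_def)
  ultimately have "\<alpha> = oriented_span (u, v)"
    by (simp add: \<alpha> pq(2) oriented_by_def)
  then show thesis
    using that uv by blast
qed

lemma oriented_onb_oriented_span:
  assumes "(u, v) \<in> stiefel"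
  shows "b' \<in> oriented_onb (oriented_span (u, v)) \<longleftrightarrow>
    b' \<in> stiefel \<and> ((u, v), b') \<in> same_orientation (span {u, v})"
  by (auto simp only: oriented_onb_def oriented_by_def prod.case snd_conv Image_singleton_iff mem_Collect_eq)

lemma oriented_onb_refl:
  assumes "(u, v) \<in> stiefel"
  shows "(u, v) \<in> oriented_onb (oriented_span (u, v))"
  using equiv_class_self [OF equiv_same_orientation stiefel_span_plane_bases [OF assms]] assms
  unfolding oriented_onb_oriented_span [OF assms] Image_singleton_iff by blast

lemma frame_to_M2_stiefel:
  assumes "(u, v) \<in> stiefel"
  shows "frame_to_M2 (u, v) = (u \<odot> v, span {oct_1, u, v, u \<odot> v})"
proof -
  have "u \<otimes>\<^sub>O v = u \<odot> v"
    using assms by (simp add: mem_stiefel ocross_orthogonal)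
  then show ?thesis
    by (simp add: frame_to_M2_def)
qed

text \<open>The determinant of a base change between orthonormal bases is \<open>1\<close> once it is positive, and the
  cross product is multiplied by it.\<close>
lemma frame_to_M2_cong:
  assumes uv: "(u, v) \<in> stiefel" and uv': "(u', v') \<in> stiefel"
    and or: "((u, v), (u', v')) \<in> same_orientation P"
  shows "frame_to_M2 (u', v') = frame_to_M2 (u, v)"
proof -
  obtain a b c d where B: "(u, v) \<in> plane_bases P" "(u', v') \<in> plane_bases P"
    and ab: "u' = a *\<^sub>R u + b *\<^sub>R v" "v' = c *\<^sub>R u + d *\<^sub>R v" and pos: "a * d - b * c > 0"
    using or by (rule same_orientationE)
  have o: "u \<bullet> u = 1" "v \<bullet> v = 1" "u \<bullet> v = 0" "v \<bullet> u = 0"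
    "u' \<bullet> u' = 1" "v' \<bullet> v' = 1" "u' \<bullet> v' = 0"
    using uv uv' by (simp_all add: mem_stiefel inner_commute)
  have "a * a + b * b = 1" "c * c + d * d = 1" "a * c + b * d = 0"
    using o(5-7) unfolding ab by (simp_all add: inner_add_left inner_add_right o algebra_simps)
  \<comment> \<open>Lagrange's identity: (ad - bc)^2 + (ac + bd)^2 = (a^2 + b^2)(c^2 + d^2).\<close>
  then have "(a * d - b * c) * (a * d - b * c) = 1"
    by algebra
  then have det: "a * d - b * c = 1"
    using pos by (metis abs_of_pos real_sqrt_abs2 real_sqrt_one)
  note t = stiefel_omult_table [OF uv]
  have "u' \<odot> v' = - (a * c + b * d) *\<^sub>R oct_1 + (a * d - b * c) *\<^sub>R (u \<odot> v)"
    unfolding ab by (simp add: omult_simps t algebra_simps)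
  then have uv_eq: "u' \<odot> v' = u \<odot> v"
    using det \<open>a * c + b * d = 0\<close> by simp
  have "span {u, v} = span {u', v'}"
    using B by (simp add: plane_bases_def)
  then have "u' \<in> span {u, v}" "v' \<in> span {u, v}" "u \<in> span {u', v'}" "v \<in> span {u', v'}"
    by (metis insertI1 insertI2 span_base)+
  then have "u' \<in> span {oct_1, u, v, u \<odot> v}" "v' \<in> span {oct_1, u, v, u \<odot> v}"
    "u \<in> span {oct_1, u', v', u \<odot> v}" "v \<in> span {oct_1, u', v', u \<odot> v}"
    by (meson insertI1 insertI2 insert_subsetI empty_subsetI span_mono subsetD)+
  then have "span {oct_1, u', v', u \<odot> v} = span {oct_1, u, v, u \<odot> v}"
    by (simp add: span_eq span_base)
  then show ?thesis
    using uv uv' by (simp add: frame_to_M2_stiefel uv_eq)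
qed

lemma Gr_to_M2_oriented_onb:
  assumes "\<alpha> \<in> Gr" "b \<in> oriented_onb \<alpha>"
  shows "Gr_to_M2 \<alpha> = frame_to_M2 b"
proof -
  obtain u v where uv: "(u, v) \<in> stiefel" "\<alpha> = oriented_span (u, v)"
    using assms(1) by (rule Gr_oriented_onb)
  have "frame_to_M2 b' = frame_to_M2 (u, v)" if "b' \<in> oriented_onb \<alpha>" for b'
  proof (cases b' rule: prod.exhaust)
    case (Pair u' v')
    then have "(u', v') \<in> stiefel" "((u, v), (u', v')) \<in> same_orientation (span {u, v})"
      using that oriented_onb_oriented_span [OF uv(1), of b'] unfolding uv(2) by blast+
    then show ?thesis
      unfolding Pair by (rule frame_to_M2_cong [OF uv(1)])
  qed
  moreover have "(SOME b. b \<in> oriented_onb \<alpha>) \<in> oriented_onb \<alpha>"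
    using assms(2) by (rule someI)
  ultimately show ?thesis
    using assms(2) unfolding Gr_to_M2_def by metis
qed

lemma Gr_to_M2_oriented_span:
  assumes "(u, v) \<in> stiefel"
  shows "Gr_to_M2 (oriented_span (u, v)) = frame_to_M2 (u, v)"
  using stiefel_oriented_by [OF assms] oriented_onb_refl [OF assms]
  by (intro Gr_to_M2_oriented_onb) simp_all

section \<open>The inverse map\<close>

lemma M2_unit_stiefel:
  assumes "(w, W) \<in> M2" "X \<in> W \<inter> orthogonal_comp (span {oct_1, w})" "X \<bullet> X = 1"
  shows "(w, X) \<in> stiefel" "W = span {oct_1, w, X, w \<odot> X}"
proof -
  have "oct_1 \<bullet> X = 0" "w \<bullet> X = 0"
    using assms(2) by (simp_all add: orthogonal_comp_def orthogonal_def span_base)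
  then show st: "(w, X) \<in> stiefel"
    using assms(1,3) by (simp add: mem_stiefel mem_Im_Oct M2_def inner_commute)
  show "W = span {oct_1, w, X, w \<odot> X}"
    using M1_eq_quat_span [OF _ st] assms(1,2) by (simp add: M2_def)
qed

lemma quat_span_plane:
  assumes "(w, X) \<in> stiefel"
  shows "span {oct_1, w, X, w \<odot> X} \<inter> orthogonal_comp (span {oct_1, w}) = span {X, w \<odot> X}"
proof (intro subset_antisym subsetI)
  note o = stiefel_orthonormal [OF assms]
  fix z assume z: "z \<in> span {oct_1, w, X, w \<odot> X} \<inter> orthogonal_comp (span {oct_1, w})"
  then obtain a b c d where abcd: "z = a *\<^sub>R oct_1 + b *\<^sub>R w + c *\<^sub>R X + d *\<^sub>R (w \<odot> X)"
    unfolding range_quat_embed [symmetric] by (auto simp: quat_embed_def)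
  have "oct_1 \<bullet> z = 0" "w \<bullet> z = 0"
    using z by (simp_all add: orthogonal_comp_def orthogonal_def span_base)
  then have "a = 0" "b = 0"
    using o by (simp_all add: abcd inner_add_right inner_commute)
  then show "z \<in> span {X, w \<odot> X}"
    unfolding abcd by (simp add: span_add span_scale span_base)
next
  note o = stiefel_orthonormal [OF assms]
  fix z assume z: "z \<in> span {X, w \<odot> X}"
  have "orthogonal z y" if "y \<in> span {oct_1, w}" for y
  proof (rule orthogonal_to_span [OF that])
    fix e assume "e \<in> {oct_1, w}"
    then have "orthogonal e X" "orthogonal e (w \<odot> X)"
      using o by (auto simp only: orthogonal_def insert_iff empty_iff)
    then have "orthogonal e z"
      using orthogonal_to_span [OF z] by blast
    then show "orthogonal z e"
      by (simp add: orthogonal_commute)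
  qed
  then have "z \<in> orthogonal_comp (span {oct_1, w})"
    by (simp add: orthogonal_comp_def orthogonal_commute)
  moreover have "z \<in> span {oct_1, w, X, w \<odot> X}"
    using z span_mono [of "{X, w \<odot> X}" "{oct_1, w, X, w \<odot> X}"] by blast
  ultimately show "z \<in> span {oct_1, w, X, w \<odot> X} \<inter> orthogonal_comp (span {oct_1, w})"
    by blast
qed

text \<open>The triple w, X, wX behaves like i, j, k and may be shifted cyclically. The first shift
  yields the frame of the plane attached to a point of \<open>M2\<close>; the second, applied to a
  frame (u, v), leads back.\<close>

lemma stiefel_rotate:
  assumes "(w, X) \<in> stiefel"
  shows "(X, w \<odot> X) \<in> stiefel" "(w \<odot> X, w) \<in> stiefel"
  using assms stiefel_omult_table [OF assms] by (simp_all add: mem_stiefel inner_commute)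

lemma M2_plane_unit_exists:
  assumes "(w, W) \<in> M2"
  shows "\<exists>X\<in>W \<inter> orthogonal_comp (span {oct_1, w}). X \<bullet> X = 1"
proof -
  obtain X where X: "X \<in> W" "(w, X) \<in> stiefel"
    using M2_frame_exists [OF assms] .
  then have "W = span {oct_1, w, X, w \<odot> X}"
    using M1_eq_quat_span assms by (simp add: M2_def)
  then have "X \<in> W \<inter> orthogonal_comp (span {oct_1, w})"
    using quat_span_plane [OF X(2)] by (simp add: span_base)
  then show ?thesis
    using X(2) by (auto simp only: mem_stiefel)
qed

text \<open>Independence of the chosen unit vector: left multiplication by w is a quarter turn of
  the plane, so another unit vector Y = cX + d wX has wY = -dX + c wX, and the base change is a
  rotation of determinant c^2 + d^2 = 1.\<close>

lemma M2_to_Gr_unit: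
  assumes M2: "(w, W) \<in> M2" and X: "X \<in> W \<inter> orthogonal_comp (span {oct_1, w})" "X \<bullet> X = 1"
  shows "M2_to_Gr (w, W) = oriented_by (W \<inter> orthogonal_comp (span {oct_1, w})) (X, w \<otimes>\<^sub>O X)"
    and "M2_to_Gr (w, W) = oriented_span (X, w \<odot> X)"
proof -
  let ?P = "W \<inter> orthogonal_comp (span {oct_1, w})"
  define Y where "Y = (SOME X. X \<in> M2_plane (w, W) \<and> X \<bullet> X = 1)"
  have Y: "Y \<in> ?P" "Y \<bullet> Y = 1"
    using someI_ex [of "\<lambda>X. X \<in> M2_plane (w, W) \<and> X \<bullet> X = 1"] M2_plane_unit_exists [OF M2]
    unfolding Y_def M2_plane_def by (simp_all add: Bex_def del: split_paired_Ex)
  have plane: "?P = span {Z, w \<odot> Z}" "(w, Z) \<in> stiefel" "(Z, w \<odot> Z) \<in> plane_bases ?P"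
    "w \<otimes>\<^sub>O Z = w \<odot> Z" if Z: "Z \<in> ?P" "Z \<bullet> Z = 1" for Z
  proof -
    show st: "(w, Z) \<in> stiefel"
      using M2_unit_stiefel [OF M2 Z] by blast
    show P: "?P = span {Z, w \<odot> Z}"
      using quat_span_plane [OF st] M2_unit_stiefel(2) [OF M2 Z] by simp
    show "(Z, w \<odot> Z) \<in> plane_bases ?P"
      unfolding P using stiefel_rotate [OF st] by (simp add: stiefel_span_plane_bases)
    show "w \<otimes>\<^sub>O Z = w \<odot> Z"
      using st by (simp add: mem_stiefel ocross_orthogonal)
  qed
  note PX = plane [OF X] and PY = plane [OF Y]
  have "Y \<in> span {X, w \<odot> X}"
    using Y(1) PX(1) by simp
  then obtain c d where cd: "Y = c *\<^sub>R X + d *\<^sub>R (w \<odot> X)"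
    by (metis (no_types, lifting) add.commute diff_eq_eq span_breakdown_eq span_singleton image_iff)
  have "w \<odot> Y = (- d) *\<^sub>R X + c *\<^sub>R (w \<odot> X)"
    by (simp add: cd omult_simps stiefel_omult_table [OF PX(2)])
  moreover have "c * c + d * d = 1"
    using Y(2) by (simp add: cd inner_add_left inner_add_right stiefel_orthonormal [OF PX(2)]
        inner_commute [of "w \<odot> X" X])
  ultimately have "((X, w \<odot> X), (Y, w \<odot> Y)) \<in> same_orientation ?P"
    by (intro same_orientationI [OF PX(3) PY(3) cd, where c = "- d" and d = c]) simp_all
  then have "oriented_by ?P (X, w \<odot> X) = oriented_by ?P (Y, w \<odot> Y)"
    using oriented_by_eq_iff [OF PX(3) PY(3)] by blast
  moreover have "M2_to_Gr (w, W) = oriented_by ?P (Y, w \<otimes>\<^sub>O Y)"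
    by (simp add: M2_to_Gr_def Let_def flip: Y_def) (simp add: M2_plane_def)
  ultimately have eq: "M2_to_Gr (w, W) = oriented_by ?P (X, w \<odot> X)"
    using PY(4) by simp
  then show "M2_to_Gr (w, W) = oriented_by ?P (X, w \<otimes>\<^sub>O X)"
    using PX(4) by simp
  show "M2_to_Gr (w, W) = oriented_span (X, w \<odot> X)"
    using eq PX(1) by simp
qed

text \<open>Because (uv)u = v, only the order of the spanning vectors changes; now the span is in
  the form belonging to the pair (uv, u).\<close>

lemma frame_to_M2_eq_quat_span:
  assumes "(u, v) \<in> stiefel"
  shows "frame_to_M2 (u, v) = (u \<odot> v, span {oct_1, u \<odot> v, u, (u \<odot> v) \<odot> u})"
  using assms by (simp add: frame_to_M2_stiefel stiefel_omult_table insert_commute)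

lemma frame_to_M2_mem: "b \<in> stiefel \<Longrightarrow> frame_to_M2 b \<in> M2"
  using frame_to_M2_eq_quat_span quat_span_M2 stiefel_rotate(2)
  by (cases b rule: prod.exhaust) metis

text \<open>The vector u is an admissible unit vector of the plane attached to w = uv, and wu = v
  restores the second vector of the frame.\<close>

lemma M2_to_Gr_frame_to_M2:
  assumes "(u, v) \<in> stiefel"
  shows "M2_to_Gr (frame_to_M2 (u, v)) = oriented_span (u, v)"
proof -
  let ?w = "u \<odot> v"
  have st: "(?w, u) \<in> stiefel"
    using stiefel_rotate(2) [OF assms] .
  have wu: "?w \<odot> u = v"
    using stiefel_omult_table [OF assms] by simp
  have "u \<in> span {oct_1, ?w, u, ?w \<odot> u} \<inter> orthogonal_comp (span {oct_1, ?w})"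
    unfolding quat_span_plane [OF st] by (simp add: span_base)
  then have "M2_to_Gr (?w, span {oct_1, ?w, u, ?w \<odot> u}) = oriented_span (u, ?w \<odot> u)"
    using quat_span_M2 [OF st] assms by (intro M2_to_Gr_unit(2)) (simp_all add: mem_stiefel)
  then show ?thesis
    using frame_to_M2_eq_quat_span [OF assms] wu by simp
qed

lemma Gr_to_M2_in_M2:
  assumes "\<alpha> \<in> Gr"
  shows "Gr_to_M2 \<alpha> \<in> M2"
proof -
  obtain u v where uv: "(u, v) \<in> stiefel" "\<alpha> = oriented_span (u, v)"
    using assms by (rule Gr_oriented_onb)
  show ?thesis
    unfolding uv(2) Gr_to_M2_oriented_span [OF uv(1)] by (rule frame_to_M2_mem [OF uv(1)])
qed

lemma M2_to_Gr_Gr_to_M2: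
  assumes "\<alpha> \<in> Gr"
  shows "M2_to_Gr (Gr_to_M2 \<alpha>) = \<alpha>"
proof -
  obtain u v where uv: "(u, v) \<in> stiefel" "\<alpha> = oriented_span (u, v)"
    using assms by (rule Gr_oriented_onb)
  show ?thesis
    unfolding uv(2) Gr_to_M2_oriented_span [OF uv(1)] by (rule M2_to_Gr_frame_to_M2 [OF uv(1)])
qed

text \<open>The frame (X, wX) of the plane has product X(wX) = w, and together with 1 and w it spans
  W.\<close>

lemma Gr_to_M2_M2_to_Gr:
  assumes "p \<in> M2"
  shows "M2_to_Gr p \<in> Gr" "Gr_to_M2 (M2_to_Gr p) = p"
proof -
  obtain w W where p: "p = (w, W)"
    by (metis prod.exhaust)
  with assms obtain X where X: "X \<in> W \<inter> orthogonal_comp (span {oct_1, w})" "X \<bullet> X = 1"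
    using M2_plane_unit_exists by blast
  note st = M2_unit_stiefel [OF assms [unfolded p] X]
  note st' = stiefel_rotate(1) [OF st(1)]
  have eq: "M2_to_Gr p = oriented_span (X, w \<odot> X)"
    unfolding p using M2_to_Gr_unit(2) [OF assms [unfolded p] X] .
  then show "M2_to_Gr p \<in> Gr"
    using stiefel_oriented_by [OF st'] by simp
  have "X \<odot> (w \<odot> X) = w"
    using stiefel_omult_table [OF st(1)] by blast
  moreover have "{oct_1, X, w \<odot> X, w} = {oct_1, w, X, w \<odot> X}"
    by blast
  ultimately have "frame_to_M2 (X, w \<odot> X) = p"
    using frame_to_M2_stiefel [OF st'] st(2) p by simp
  then show "Gr_to_M2 (M2_to_Gr p) = p"
    using Gr_to_M2_oriented_span [OF st'] eq by simp
qed

section \<open>Compactness of the Stiefel manifold and the homeomorphism with the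
  Grassmannian\<close>

lemma compact_stiefel: "compact stiefel"
proof -
  have eq: "stiefel = (cball 0 1 \<times> cball 0 1) \<inter> {b. fst b \<bullet> oct_1 = 0 \<and> snd b \<bullet> oct_1 = 0 \<and>
      fst b \<bullet> fst b = 1 \<and> snd b \<bullet> snd b = 1 \<and> fst b \<bullet> snd b = 0}" (is "_ = ?K \<inter> ?C")
    by (auto simp only: stiefel_def mem_Im_Oct norm_eq_sqrt_inner mem_cball_0 real_sqrt_one fst_conv snd_conv)
  have closed: "closed ?C"
    by (intro closed_Collect_conj closed_Collect_eq continuous_intros)
  have compact: "compact ?K"
    by (intro compact_Times compact_cball)
  show ?thesis
    unfolding eq using compact closed by (rule compact_Int_closed)
qed

lemma Gr_to_M2_homeomorphic: "homeomorphic_map Gr_top M2_top Gr_to_M2"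
  unfolding Gr_top_def
proof (rule compact_quotient_homeomorphic_map)
  show "compact_space (top_of_set stiefel)"
    using compact_stiefel by (intro compact_space_subtopology) simp
  show "oriented_span ` topspace (top_of_set stiefel) = Gr"
    using stiefel_oriented_by by (auto simp only: topspace_euclidean_subtopology elim!: Gr_oriented_onb)
  have "continuous_on stiefel (\<lambda>b. (fst b \<odot> snd b, fst b))"
    by (intro continuous_intros omult.continuous_on)
  then have "continuous_map (top_of_set stiefel) (top_of_set stiefel) (\<lambda>b. (fst b \<odot> snd b, fst b))"
    using stiefel_rotate(2) by (auto simp only: continuous_map_subtopology_eu fst_conv snd_conv)
  from continuous_map_compose [OF this continuous_map_quat_span]
  show "continuous_map (top_of_set stiefel) M2_top (Gr_to_M2 \<circ> oriented_span)"
  proof (rule continuous_map_eq)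
    fix b assume "b \<in> topspace (top_of_set stiefel)"
    then show "((\<lambda>(w, X). (w, span {oct_1, w, X, w \<odot> X})) \<circ> (\<lambda>b. (fst b \<odot> snd b, fst b))) b =
        (Gr_to_M2 \<circ> oriented_span) b"
      using Gr_to_M2_oriented_span [of "fst b" "snd b"] frame_to_M2_eq_quat_span [of "fst b" "snd b"] by simp
  qed
  show "inj_on Gr_to_M2 Gr"
    using M2_to_Gr_Gr_to_M2 by (rule inj_on_inverseI)
  show "Gr_to_M2 ` Gr = topspace M2_top"
    unfolding topspace_M2_top using Gr_to_M2_in_M2 Gr_to_M2_M2_to_Gr by (metis image_eqI image_subsetI subsetI subset_antisym)
qed (rule Hausdorff_space_M2_top)

text \<open>Some continuous inverse exists, and on \<open>M2\<close> it must agree with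
  \<open>M2_to_Gr\<close>. This yields continuity of \<open>M2_to_Gr\<close> without analysing the
  choice of X in its definition.\<close>

lemma Gr_M2_homeomorphic_maps: "homeomorphic_maps Gr_top M2_top Gr_to_M2 M2_to_Gr"
proof -
  obtain g where g: "homeomorphic_maps Gr_top M2_top Gr_to_M2 g"
    using Gr_to_M2_homeomorphic homeomorphic_map_maps by blast
  have "g p = M2_to_Gr p" if "p \<in> M2" for p
  proof -
    have "g p \<in> Gr" "Gr_to_M2 (g p) = p"
      using g that by (auto simp: homeomorphic_maps_def continuous_map_def topspace_M2_top topspace_Gr_top)
    then show ?thesis
      by (metis M2_to_Gr_Gr_to_M2)
  qed
  then show ?thesis
    using g by (auto intro: homeomorphic_maps_eq simp: topspace_M2_top)
qed

section \<open>Equivariance\<close>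

lemma octonion_aut_stiefel: "octonion_aut f \<Longrightarrow> (f u, f v) \<in> stiefel \<longleftrightarrow> (u, v) \<in> stiefel"
  by (simp add: mem_stiefel octonion_aut_Im octonion_aut_inner)

lemma octonion_aut_plane_bases:
  assumes "octonion_aut f" "(u, v) \<in> plane_bases P"
  shows "(f u, f v) \<in> plane_bases (f ` P)"
proof -
  have f: "linear f" "inj f"
    using assms(1) by (simp_all add: octonion_aut_linear octonion_aut_inj)
  have uv: "u \<noteq> v" "independent {u, v}" "span {u, v} = P"
    using assms(2) by (simp_all add: plane_bases_def)
  have "independent (f ` {u, v})"
    using f(1) uv(2) inj_on_subset [OF f(2) subset_UNIV] by (rule linear_independent_injective_image)
  moreover have "span (f ` {u, v}) = f ` P"
    using linear_span_image [OF f(1), of "{u, v}"] uv(3) by simp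
  moreover have "f u \<noteq> f v"
    using uv(1) f(2) by (simp add: inj_eq)
  ultimately show ?thesis
    by (simp add: plane_bases_def)
qed

lemma octonion_aut_same_orientation:
  assumes "octonion_aut f" "(p, q) \<in> same_orientation P"
  shows "(map_prod f f p, map_prod f f q) \<in> same_orientation (f ` P)"
proof -
  obtain u v u' v' where eqs: "p = (u, v)" "q = (u', v')"
    by (metis prod.exhaust)
  obtain a b c d where B: "(u, v) \<in> plane_bases P" "(u', v') \<in> plane_bases P"
    and ab: "u' = a *\<^sub>R u + b *\<^sub>R v" "v' = c *\<^sub>R u + d *\<^sub>R v" and pos: "a * d - b * c > 0"
    using assms(2) unfolding eqs by (rule same_orientationE)
  have "f u' = a *\<^sub>R f u + b *\<^sub>R f v" "f v' = c *\<^sub>R f u + d *\<^sub>R f v"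
    using octonion_aut_linear [OF assms(1)] by (simp_all add: ab linear_add linear_scale)
  then show ?thesis
    unfolding eqs map_prod_simp
    using same_orientationI [OF octonion_aut_plane_bases [OF assms(1) B(1)] octonion_aut_plane_bases [OF assms(1) B(2)]] pos
    by blast
qed

text \<open>The inclusion from right to left is the forward statement applied to the inverse
  automorphism.\<close>

lemma octonion_aut_orientation_class:
  assumes "octonion_aut f"
  shows "map_prod f f ` (same_orientation P `` {b}) = same_orientation (f ` P) `` {map_prod f f b}"
proof (intro subset_antisym subsetI)
  fix q assume "q \<in> map_prod f f ` (same_orientation P `` {b})"
  then obtain p where "q = map_prod f f p" "(b, p) \<in> same_orientation P"
    by (elim imageE) (simp only: Image_singleton_iff)
  then show "q \<in> same_orientation (f ` P) `` {map_prod f f b}"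
    using octonion_aut_same_orientation [OF assms] by blast
next
  fix q assume "q \<in> same_orientation (f ` P) `` {map_prod f f b}"
  then have q: "(map_prod f f b, q) \<in> same_orientation (f ` P)"
    by (simp add: Image_singleton_iff)
  let ?g = "inv_into UNIV f"
  have g: "octonion_aut ?g" "?g \<circ> f = id" "f \<circ> ?g = id"
    using octonion_aut_inv [OF assms] octonion_aut_inj [OF assms] octonion_aut_surj [OF assms]
    by (simp_all add: surj_iff)
  have "(map_prod ?g ?g (map_prod f f b), map_prod ?g ?g q) \<in> same_orientation (?g ` f ` P)"
    by (rule octonion_aut_same_orientation [OF g(1) q])
  moreover have "map_prod ?g ?g (map_prod f f b) = b" "?g ` f ` P = P"
    using map_prod.comp [of ?g ?g f f] g(2) by (simp_all add: map_prod.compositionality map_prod.id image_comp)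
  moreover have "map_prod f f (map_prod ?g ?g q) = q"
    using g(3) by (simp add: map_prod.compositionality map_prod.id)
  ultimately show "q \<in> map_prod f f ` (same_orientation P `` {b})"
    by (metis Image_singleton_iff image_eqI)
qed

lemma Gr_act_oriented_span:
  assumes "octonion_aut f" "(u, v) \<in> stiefel"
  shows "Gr_act f (oriented_span (u, v)) = oriented_span (f u, f v)"
proof -
  have "f ` span {u, v} = span {f u, f v}"
    using linear_span_image [OF octonion_aut_linear [OF assms(1)], of "{u, v}"] by simp
  then show ?thesis
    using stiefel_oriented_by [OF assms(2)] octonion_aut_orientation_class [OF assms(1), of "span {u, v}" "(u, v)"]
    by (simp add: Gr_act_def oriented_by_def)
qed

lemma group_action_Gr: "group_action G2 Gr Gr_act"
proof (rule group_actionI [OF group_G2])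
  have closed: "Gr_act f \<alpha> \<in> Gr" if f: "octonion_aut f" and \<alpha>: "\<alpha> \<in> Gr" for f \<alpha>
  proof -
    obtain u v where uv: "(u, v) \<in> stiefel" "\<alpha> = oriented_span (u, v)"
      using \<alpha> by (rule Gr_oriented_onb)
    then have "(f u, f v) \<in> stiefel"
      using f by (simp add: octonion_aut_stiefel)
    then show ?thesis
      unfolding uv(2) Gr_act_oriented_span [OF f uv(1)] by (simp add: stiefel_oriented_by)
  qed
  then show "Gr_act f \<alpha> \<in> Gr" if "f \<in> carrier G2" "\<alpha> \<in> Gr" for f \<alpha>
    using that by simp
  show "Gr_act (f \<otimes>\<^bsub>G2\<^esub> g) \<alpha> = Gr_act f (Gr_act g \<alpha>)"
    if "f \<in> carrier G2" "g \<in> carrier G2" "\<alpha> \<in> Gr" for f g \<alpha>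
  proof -
    obtain P c where \<alpha>: "\<alpha> = (P, c)"
      by (metis prod.exhaust)
    have "Gr_act g \<alpha> \<in> Gr"
      using that closed by simp
    then show ?thesis
      using that(3) by (simp add: \<alpha> Gr_act_def image_comp map_prod.comp)
  qed
qed (auto simp: Gr_act_def map_prod.id)

lemma Gr_to_M2_equivariant:
  assumes "octonion_aut f" "\<alpha> \<in> Gr"
  shows "Gr_to_M2 (Gr_act f \<alpha>) = M2_act f (Gr_to_M2 \<alpha>)"
proof -
  obtain u v where uv: "(u, v) \<in> stiefel" "\<alpha> = oriented_span (u, v)"
    using assms(2) by (rule Gr_oriented_onb)
  have fuv: "(f u, f v) \<in> stiefel"
    using uv(1) assms(1) by (simp add: octonion_aut_stiefel)
  have "Gr_to_M2 (Gr_act f \<alpha>) = frame_to_M2 (f u, f v)"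
    unfolding uv(2) Gr_act_oriented_span [OF assms(1) uv(1)] by (rule Gr_to_M2_oriented_span [OF fuv])
  also have "\<dots> = (f (u \<odot> v), f ` span {oct_1, u, v, u \<odot> v})"
    using linear_span_image [OF octonion_aut_linear [OF assms(1)], of "{oct_1, u, v, u \<odot> v}"]
    by (simp add: frame_to_M2_stiefel [OF fuv] octonion_aut_omult [OF assms(1)] octonion_aut_one [OF assms(1)])
  also have "\<dots> = M2_act f (frame_to_M2 (u, v))"
    using frame_to_M2_mem [OF uv(1)] by (simp add: frame_to_M2_stiefel [OF uv(1)] M2_act_def)
  finally show ?thesis
    unfolding uv(2) Gr_to_M2_oriented_span [OF uv(1)] .
qed

theorem mainTheorem7:
  shows
    "transitive_action G2 M2 M2_act \<and>
     (oct_i, Quat) \<in> M2 \<and>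
     stabilizer G2 M2_act (oct_i, Quat) = H2 \<and>
     (\<lambda>f. restrict f Quat_perp) \<in> iso (G2\<lparr>carrier := H2\<rparr>) U_sigma \<and>
     homeomorphic_map (top_of_set H2) (top_of_set (carrier U_sigma)) (\<lambda>f. restrict f Quat_perp) \<and>
     (\<exists>h \<in> iso U_sigma U2. homeomorphic_map (top_of_set (carrier U_sigma)) (top_of_set (carrier U2)) h) \<and>
     (\<exists>\<Psi>. homeomorphic_map G2_mod_H2_top M2_top \<Psi> \<and>
          (\<forall>f \<in> carrier G2. \<Psi> (f <#\<^bsub>G2\<^esub> H2) = M2_act f (oct_i, Quat)) \<and>
          (\<forall>f \<in> carrier G2. \<forall>C \<in> lcosets\<^bsub>G2\<^esub> H2. \<Psi> (f <#\<^bsub>G2\<^esub> C) = M2_act f (\<Psi> C))) \<and>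
     group_action G2 Gr Gr_act \<and>
     (\<forall>\<alpha> \<in> Gr. oriented_onb \<alpha> \<noteq> {} \<and>
        (\<forall>(X1, X2) \<in> oriented_onb \<alpha>.
           Gr_to_M2 \<alpha> = (X1 \<otimes>\<^sub>O X2, span {oct_1, X1, X2, X1 \<otimes>\<^sub>O X2}))) \<and>
     (\<forall>(w, W) \<in> M2. (\<exists>X \<in> W \<inter> orthogonal_comp (span {oct_1, w}). X \<bullet> X = 1) \<and>
        (\<forall>X \<in> W \<inter> orthogonal_comp (span {oct_1, w}). X \<bullet> X = 1 \<longrightarrow>
           M2_to_Gr (w, W) = oriented_by (W \<inter> orthogonal_comp (span {oct_1, w})) (X, w \<otimes>\<^sub>O X))) \<and>
     homeomorphic_maps Gr_top M2_top Gr_to_M2 M2_to_Gr \<and>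
     (\<forall>f \<in> carrier G2. \<forall>\<alpha> \<in> Gr. Gr_to_M2 (Gr_act f \<alpha>) = M2_act f (Gr_to_M2 \<alpha>))"
proof (intro conjI)
  show "transitive_action G2 M2 M2_act"
    by (rule transitive_action_M2)
  show "(oct_i, Quat) \<in> M2"
    by (rule base_M2)
  show "stabilizer G2 M2_act (oct_i, Quat) = H2"
    by (rule stabilizer_M2)
  show "(\<lambda>f. restrict f Quat_perp) \<in> iso (G2\<lparr>carrier := H2\<rparr>) U_sigma"
    by (rule restrict_H2_iso)
  show "homeomorphic_map (top_of_set H2) (top_of_set (carrier U_sigma)) (\<lambda>f. restrict f Quat_perp)"
    by (rule restrict_H2_homeomorphic)
  show "\<exists>h\<in>iso U_sigma U2. homeomorphic_map (top_of_set (carrier U_sigma)) (top_of_set (carrier U2)) h"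
    using perp_matrix_homeomorphic perp_matrix_iso by (rule bexI)
  show "\<exists>\<Psi>. homeomorphic_map G2_mod_H2_top M2_top \<Psi> \<and>
      (\<forall>f\<in>carrier G2. \<Psi> (f <#\<^bsub>G2\<^esub> H2) = M2_act f (oct_i, Quat)) \<and>
      (\<forall>f\<in>carrier G2. \<forall>C\<in>lcosets\<^bsub>G2\<^esub> H2. \<Psi> (f <#\<^bsub>G2\<^esub> C) = M2_act f (\<Psi> C))"
    using coset_orbit_homeomorphic coset_orbit_eq coset_orbit_equivariant by blast
  show "group_action G2 Gr Gr_act"
    by (rule group_action_Gr)
  show "\<forall>\<alpha>\<in>Gr. oriented_onb \<alpha> \<noteq> {} \<and> (\<forall>(X1, X2)\<in>oriented_onb \<alpha>.
      Gr_to_M2 \<alpha> = (X1 \<otimes>\<^sub>O X2, span {oct_1, X1, X2, X1 \<otimes>\<^sub>O X2}))"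
  proof (rule ballI, rule conjI)
    fix \<alpha> assume \<alpha>: "\<alpha> \<in> Gr"
    then obtain u v where "(u, v) \<in> stiefel" "\<alpha> = oriented_span (u, v)"
      by (rule Gr_oriented_onb)
    then show "oriented_onb \<alpha> \<noteq> {}"
      using oriented_onb_refl by blast
    have "Gr_to_M2 \<alpha> = (X1 \<otimes>\<^sub>O X2, span {oct_1, X1, X2, X1 \<otimes>\<^sub>O X2})"
      if "(X1, X2) \<in> oriented_onb \<alpha>" for X1 X2
      using Gr_to_M2_oriented_onb [OF \<alpha> that] by (simp add: frame_to_M2_def)
    then show "\<forall>(X1, X2)\<in>oriented_onb \<alpha>. Gr_to_M2 \<alpha> = (X1 \<otimes>\<^sub>O X2, span {oct_1, X1, X2, X1 \<otimes>\<^sub>O X2})"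
      by blast
  qed
  show "\<forall>(w, W)\<in>M2. (\<exists>X\<in>W \<inter> orthogonal_comp (span {oct_1, w}). X \<bullet> X = 1) \<and>
      (\<forall>X\<in>W \<inter> orthogonal_comp (span {oct_1, w}). X \<bullet> X = 1 \<longrightarrow>
        M2_to_Gr (w, W) = oriented_by (W \<inter> orthogonal_comp (span {oct_1, w})) (X, w \<otimes>\<^sub>O X))"
    using M2_plane_unit_exists M2_to_Gr_unit(1) by blast
  show "homeomorphic_maps Gr_top M2_top Gr_to_M2 M2_to_Gr"
    by (rule Gr_M2_homeomorphic_maps)
  show "\<forall>f\<in>carrier G2. \<forall>\<alpha>\<in>Gr. Gr_to_M2 (Gr_act f \<alpha>) = M2_act f (Gr_to_M2 \<alpha>)"
    using Gr_to_M2_equivariant by simp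
qed

end
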